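(* Let $\Omega\subset\mathbb R^N$ ($N\ge2$) be an exterior domain of class $C^2$ and $(u_0,v_0)\in\Theta$. Then for every $0\le c<2\sqrt{d_1r_1(1-a_1)}$, $$\sup_{x\in\overline\Omega,\,|x|\le ct}\big(|1-u(t,x)|+|v(t,x)|\big)\to0\quad\text{as }t\to\infty.$$ In particular, for all $e\in\mathbb S^{N-1}$ and $z\in\mathbb R^N$, $$w^*(e,u_0,v_0)\ge w^*(e,z,u_0,v_0)\ge w_*(e,z,u_0,v_0)\ge w_*(e,u_0,v_0)\ge 2\sqrt{d_1r_1(1-a_1)}.$$
   Context: An exterior domain is a non-empty connected open $\Omega\subset\mathbb R^N$ with $\mathbb R^N\setminus\Omega$ compact. Fix positive constants $d_1,d_2,r_1,r_2,a_1,a_2$ with $0<a_1<1<a_2$. $\Theta$ is the set of pairs $(u_0,v_0)$ with $u_0,v_0\in C(\overline\Omega,[0,1])$, $u_0\not\equiv 0$, $(u_0,v_0)=(0,1)$ outside a compact subset of $\overline\Omega$; $(u,v)$ is the solution of $u_t=d_1\Delta u+r_1u(1-u-a_1v)$, $v_t=d_2\Delta v+r_2v(1-v-a_2u)$ in $(0,\infty)\times\Omega$, homogeneous Neumann conditions on $\partial\Omega$, $(u,v)(0,\cdot)=(u_0,v_0)$. $R(e)=\inf\{R\ge0:\exists s,\ \forall s'\ge s,\ \overline{B(s'e,R)}\cap\overline\Omega\ne\emptyset\}$. $w^*(e,u_0,v_0)=\inf\{c>0:\forall A>R(e),\ \lim_{t\to\infty}\sup_{s\ge ct,\,x\in\overline{B(se,A)}\cap\overline\Omega}(|u|+|1-v|)(t,x)=0\}$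 ($+\infty$ if empty); $w^*(e,z,u_0,v_0)$: same with "$\exists A>0$" and $B(z+se,A)$. $w_*(e,u_0,v_0)=\sup\{c>0:\forall A>R(e),\ \limsup_{\tau,t\to\infty,\,\tau\le ct}\sup_{\tau\le s\le ct,\,x\in\overline{B(se,A)}\cap\overline\Omega}(|1-u|+|v|)(t,x)=0\}$ ($0$ if empty); $w_*(e,z,u_0,v_0)$: same with "$\exists A>0$" and $B(z+se,A)$. *)

theory Defs
  imports "HOL-Analysis.Analysis"
begin

definition exterior_domain :: "'a::euclidean_space set \<Rightarrow> bool" where
  "exterior_domain \<Omega> \<longleftrightarrow> open \<Omega> \<and> connected \<Omega> \<and> \<Omega> \<noteq> {} \<and> compact (- \<Omega>)"

text \<open>A local C^2 defining function of \<Omega> near a boundary point p: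
  rho is C^2 on ball p r with gradient g (nonvanishing), Hessian G continuous,
  and \<Omega> \<inter> ball p r = {rho < 0} \<inter> ball p r.  Then g p is an outward normal at p.\<close>
definition local_C2_defining ::
  "'a::euclidean_space set \<Rightarrow> 'a \<Rightarrow> real \<Rightarrow> ('a \<Rightarrow> real) \<Rightarrow> ('a \<Rightarrow> 'a) \<Rightarrow> bool" where
  "local_C2_defining \<Omega> p r \<rho> g \<longleftrightarrow> r > 0 \<and>
     (\<exists>G. (\<forall>x\<in>ball p r. (\<rho> has_derivative (\<lambda>h. g x \<bullet> h)) (at x)
                          \<and> (g has_derivative G x) (at x) \<and> g x \<noteq> 0)
        \<and> (\<forall>h. continuous_on (ball p r) (\<lambda>x. G x h)))
     \<and> \<Omega> \<inter> ball p r = {x \<in> ball p r. \<rho> x < 0}"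

definition C2_domain :: "'a::euclidean_space set \<Rightarrow> bool" where
  "C2_domain \<Omega> \<longleftrightarrow> (\<forall>p\<in>frontier \<Omega>. \<exists>r \<rho> g. local_C2_defining \<Omega> p r \<rho> g)"

definition in_Theta :: "'a::euclidean_space set \<Rightarrow> ('a \<Rightarrow> real) \<Rightarrow> ('a \<Rightarrow> real) \<Rightarrow> bool" where
  "in_Theta \<Omega> u0 v0 \<longleftrightarrow>
     continuous_on (closure \<Omega>) u0 \<and> continuous_on (closure \<Omega>) v0
   \<and> (\<forall>x\<in>closure \<Omega>. 0 \<le> u0 x \<and> u0 x \<le> 1 \<and> 0 \<le> v0 x \<and> v0 x \<le> 1)
   \<and> (\<exists>x\<in>closure \<Omega>. u0 x \<noteq> 0)
   \<and> (\<exists>K. compact K \<and> K \<subseteq> closure \<Omega> \<and> (\<forall>x\<in>closure \<Omega> - K. u0 x = 0 \<and> v0 x = 1))"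

definition classical_neumann_eq ::
  "'a::euclidean_space set \<Rightarrow> real \<Rightarrow> (real \<Rightarrow> 'a \<Rightarrow> real) \<Rightarrow> (real \<Rightarrow> 'a \<Rightarrow> real) \<Rightarrow> bool" where
  "classical_neumann_eq \<Omega> d f w \<longleftrightarrow>
     (\<exists>wt gw Hw.
        (\<forall>t>0. \<forall>x\<in>\<Omega>.
            ((\<lambda>s. w s x) has_real_derivative wt t x) (at t)
          \<and> (w t has_derivative (\<lambda>h. gw t x \<bullet> h)) (at x)
          \<and> (gw t has_derivative Hw t x) (at x)
          \<and> wt t x = d * (\<Sum>i\<in>Basis. Hw t x i \<bullet> i) + f t x)
      \<and> continuous_on ({0<..} \<times> \<Omega>) (\<lambda>(t,x). wt t x)
      \<and> (\<forall>h. continuous_on ({0<..} \<times> \<Omega>) (\<lambda>(t,x). Hw t x h)))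
   \<and> (\<forall>t>0. \<forall>p\<in>frontier \<Omega>. \<exists>D. (w t has_derivative D) (at p within closure \<Omega>)
          \<and> (\<forall>r \<rho> g. local_C2_defining \<Omega> p r \<rho> g \<longrightarrow> D (g p) = 0))"

definition LV_solution ::
  "'a::euclidean_space set \<Rightarrow> real \<Rightarrow> real \<Rightarrow> real \<Rightarrow> real \<Rightarrow> real \<Rightarrow> real \<Rightarrow>
   ('a \<Rightarrow> real) \<Rightarrow> ('a \<Rightarrow> real) \<Rightarrow> (real \<Rightarrow> 'a \<Rightarrow> real) \<Rightarrow> (real \<Rightarrow> 'a \<Rightarrow> real) \<Rightarrow> bool" where
  "LV_solution \<Omega> d1 d2 r1 r2 a1 a2 u0 v0 u v \<longleftrightarrow>
     continuous_on ({0..} \<times> closure \<Omega>) (\<lambda>(t,x). u t x)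
   \<and> continuous_on ({0..} \<times> closure \<Omega>) (\<lambda>(t,x). v t x)
   \<and> bounded ((\<lambda>(t,x). u t x) ` ({0..} \<times> closure \<Omega>))
   \<and> bounded ((\<lambda>(t,x). v t x) ` ({0..} \<times> closure \<Omega>))
   \<and> (\<forall>x\<in>closure \<Omega>. u 0 x = u0 x \<and> v 0 x = v0 x)
   \<and> classical_neumann_eq \<Omega> d1 (\<lambda>t x. r1 * u t x * (1 - u t x - a1 * v t x)) u
   \<and> classical_neumann_eq \<Omega> d2 (\<lambda>t x. r2 * v t x * (1 - v t x - a2 * u t x)) v"

definition R_dir :: "'a::euclidean_space set \<Rightarrow> 'a \<Rightarrow> real" where
  "R_dir \<Omega> e = Inf {R. R \<ge> 0 \<and> (\<exists>s. \<forall>s'\<ge>s. cball (s' *\<^sub>R e) R \<inter> closure \<Omega> \<noteq> {})}"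

definition w_upper :: "'a::euclidean_space set \<Rightarrow> (real \<Rightarrow> 'a \<Rightarrow> real) \<Rightarrow> (real \<Rightarrow> 'a \<Rightarrow> real) \<Rightarrow> 'a \<Rightarrow> ereal" where
  "w_upper \<Omega> u v e = Inf (ereal ` {c. c > 0 \<and> (\<forall>A > R_dir \<Omega> e. \<forall>\<epsilon>>0.
      eventually (\<lambda>t. \<forall>s \<ge> c * t. \<forall>x\<in>cball (s *\<^sub>R e) A \<inter> closure \<Omega>.
                         \<bar>u t x\<bar> + \<bar>1 - v t x\<bar> < \<epsilon>) at_top)})"

definition w_upper_z :: "'a::euclidean_space set \<Rightarrow> (real \<Rightarrow> 'a \<Rightarrow> real) \<Rightarrow> (real \<Rightarrow> 'a \<Rightarrow> real) \<Rightarrow> 'a \<Rightarrow> 'a \<Rightarrow> ereal" where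
  "w_upper_z \<Omega> u v e z = Inf (ereal ` {c. c > 0 \<and> (\<exists>A > 0. \<forall>\<epsilon>>0.
      eventually (\<lambda>t. \<forall>s \<ge> c * t. \<forall>x\<in>cball (z + s *\<^sub>R e) A \<inter> closure \<Omega>.
                         \<bar>u t x\<bar> + \<bar>1 - v t x\<bar> < \<epsilon>) at_top)})"

text \<open>The limsup over tau,t to infinity with tau <= c t of the (nonnegative) sup is 0.
  The value is 0 when the set of admissible c is empty.\<close>
definition w_lower :: "'a::euclidean_space set \<Rightarrow> (real \<Rightarrow> 'a \<Rightarrow> real) \<Rightarrow> (real \<Rightarrow> 'a \<Rightarrow> real) \<Rightarrow> 'a \<Rightarrow> ereal" where
  "w_lower \<Omega> u v e = (let C = {c. c > 0 \<and> (\<forall>A > R_dir \<Omega> e. \<forall>\<epsilon>>0. \<exists>T. \<forall>\<tau> t.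
      T \<le> \<tau> \<longrightarrow> T \<le> t \<longrightarrow> \<tau> \<le> c * t \<longrightarrow>
        (\<forall>s. \<tau> \<le> s \<and> s \<le> c * t \<longrightarrow> (\<forall>x\<in>cball (s *\<^sub>R e) A \<inter> closure \<Omega>.
              \<bar>1 - u t x\<bar> + \<bar>v t x\<bar> < \<epsilon>)))}
    in if C = {} then 0 else Sup (ereal ` C))"

definition w_lower_z :: "'a::euclidean_space set \<Rightarrow> (real \<Rightarrow> 'a \<Rightarrow> real) \<Rightarrow> (real \<Rightarrow> 'a \<Rightarrow> real) \<Rightarrow> 'a \<Rightarrow> 'a \<Rightarrow> ereal" where
  "w_lower_z \<Omega> u v e z = (let C = {c. c > 0 \<and> (\<exists>A > 0. \<forall>\<epsilon>>0. \<exists>T. \<forall>\<tau> t.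
      T \<le> \<tau> \<longrightarrow> T \<le> t \<longrightarrow> \<tau> \<le> c * t \<longrightarrow>
        (\<forall>s. \<tau> \<le> s \<and> s \<le> c * t \<longrightarrow> (\<forall>x\<in>cball (z + s *\<^sub>R e) A \<inter> closure \<Omega>.
              \<bar>1 - u t x\<bar> + \<bar>v t x\<bar> < \<epsilon>)))}
    in if C = {} then 0 else Sup (ereal ` C))"

end

theory Submission
  imports Defs
begin

text \<open>
  Everything follows from one comparison principle for the Neumann problem in the exterior domain.
  Since the comparison functions need only satisfy weak inequalities, one perturbs by a coercive
  function with positive normal derivative on the boundary, glued from local defining functions.

  With \<open>0 \<le> u, v \<le> 1\<close>, expanding bumps show that \<open>u\<close> is positive up to the boundary for
  \<open>t > 0\<close>. As \<open>v \<le> 1\<close>, \<open>u\<close> is a supersolution of the KPP equation with growth rate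
  \<open>r1 * (1 - a1)\<close>, so compactly supported bumps can travel radially at any speed below
  \<open>2 * sqrt (d1 * r1 * (1 - a1))\<close> underneath \<open>u\<close>; a constant then bounds \<open>u\<close> from below around
  the obstacle. Hence \<open>u\<close> stays away from 0 in \<open>|x| \<le> c * t\<close>. There the kinetics dominate: a
  bound \<open>v \<le> \<beta>\<close> yields \<open>u \<ge> 1 - a1 * \<beta>\<close> in any slower cone, and \<open>u \<ge> \<alpha>\<close> yields
  \<open>v \<le> max 0 (1 - a2 * \<alpha>)\<close>. Because \<open>a1 < 1 < a2\<close> the only bounds compatible with both
  implications are \<open>u \<ge> 1\<close> and \<open>v \<le> 0\<close>.
\<close>

section \<open>Functions with a gradient and a Laplacian\<close>

definition laplace_on :: "'a::euclidean_space set \<Rightarrow> ('a \<Rightarrow> real) \<Rightarrow> ('a \<Rightarrow> 'a) \<Rightarrow> ('a \<Rightarrow> real) \<Rightarrow> bool" where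
  "laplace_on S f g L \<longleftrightarrow> (\<forall>x\<in>S. (f has_derivative (\<lambda>h. g x \<bullet> h)) (at x)
     \<and> (\<exists>H. (g has_derivative H) (at x) \<and> (\<Sum>i\<in>Basis. H i \<bullet> i) = L x))"

lemma laplace_on_const: "laplace_on S (\<lambda>x. c) (\<lambda>x. 0) (\<lambda>x. 0)"
  unfolding laplace_on_def by (auto intro!: derivative_eq_intros exI[of _ "\<lambda>h. 0"])

lemma laplace_on_add:
  assumes "laplace_on S f g L" "laplace_on S f' g' L'"
  shows "laplace_on S (\<lambda>x. f x + f' x) (\<lambda>x. g x + g' x) (\<lambda>x. L x + L' x)"
  unfolding laplace_on_def
proof (intro ballI conjI)
  fix x assume x: "x \<in> S"
  obtain H H' where H: "(g has_derivative H) (at x)" "(\<Sum>i\<in>Basis. H i \<bullet> i) = L x"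
      "(g' has_derivative H') (at x)" "(\<Sum>i\<in>Basis. H' i \<bullet> i) = L' x"
    using assms x unfolding laplace_on_def by blast
  show "((\<lambda>x. f x + f' x) has_derivative (\<lambda>h. (g x + g' x) \<bullet> h)) (at x)"
    using assms x unfolding laplace_on_def
    by (auto intro!: derivative_eq_intros simp: inner_add_left)
  show "\<exists>H. ((\<lambda>x. g x + g' x) has_derivative H) (at x) \<and> (\<Sum>i\<in>Basis. H i \<bullet> i) = L x + L' x"
    using H by (intro exI[of _ "\<lambda>h. H h + H' h"])
      (auto intro!: derivative_eq_intros simp: inner_add_left sum.distrib)
qed

lemma laplace_on_mult:
  assumes "laplace_on S f g L" "laplace_on S f' g' L'"
  shows "laplace_on S (\<lambda>x. f x * f' x) (\<lambda>x. f x *\<^sub>R g' x + f' x *\<^sub>R g x)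
           (\<lambda>x. f x * L' x + f' x * L x + 2 * (g x \<bullet> g' x))"
  unfolding laplace_on_def
proof (intro ballI conjI)
  fix x assume x: "x \<in> S"
  obtain H H' where H: "(g has_derivative H) (at x)" "(\<Sum>i\<in>Basis. H i \<bullet> i) = L x"
      "(g' has_derivative H') (at x)" "(\<Sum>i\<in>Basis. H' i \<bullet> i) = L' x"
    using assms x unfolding laplace_on_def by blast
  have f: "(f has_derivative (\<lambda>h. g x \<bullet> h)) (at x)" "(f' has_derivative (\<lambda>h. g' x \<bullet> h)) (at x)"
    using assms x unfolding laplace_on_def by auto
  show "((\<lambda>x. f x * f' x) has_derivative (\<lambda>h. (f x *\<^sub>R g' x + f' x *\<^sub>R g x) \<bullet> h)) (at x)"
    using has_derivative_mult[OF f] by (simp add: inner_add_left algebra_simps)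
  have "((\<lambda>x. f x *\<^sub>R g' x + f' x *\<^sub>R g x) has_derivative
     (\<lambda>h. (f x *\<^sub>R H' h + (g x \<bullet> h) *\<^sub>R g' x) + (f' x *\<^sub>R H h + (g' x \<bullet> h) *\<^sub>R g x))) (at x)"
    by (rule has_derivative_add[OF has_derivative_scaleR[OF f(1) H(3)] has_derivative_scaleR[OF f(2) H(1)]])
  moreover have "(\<Sum>i\<in>Basis. ((f x *\<^sub>R H' i + (g x \<bullet> i) *\<^sub>R g' x) + (f' x *\<^sub>R H i + (g' x \<bullet> i) *\<^sub>R g x)) \<bullet> i)
     = f x * L' x + f' x * L x + 2 * (g x \<bullet> g' x)"
    by (simp add: inner_add_left sum.distrib H(2)[symmetric] H(4)[symmetric] sum_distrib_left
        euclidean_inner[of "g x" "g' x"] algebra_simps)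
  ultimately show "\<exists>H. ((\<lambda>x. f x *\<^sub>R g' x + f' x *\<^sub>R g x) has_derivative H) (at x) \<and>
      (\<Sum>i\<in>Basis. H i \<bullet> i) = f x * L' x + f' x * L x + 2 * (g x \<bullet> g' x)"
    by blast
qed

lemma laplace_on_cmult:
  assumes "laplace_on S f g L"
  shows "laplace_on S (\<lambda>x. c * f x) (\<lambda>x. c *\<^sub>R g x) (\<lambda>x. c * L x)"
  using laplace_on_mult[OF laplace_on_const[of S c] assms] by simp

lemma laplace_on_compose:
  assumes "laplace_on S f g L"
    and F: "\<And>r. (F has_real_derivative F' r) (at r)" "\<And>r. (F' has_real_derivative F'' r) (at r)"
  shows "laplace_on S (\<lambda>x. F (f x)) (\<lambda>x. F' (f x) *\<^sub>R g x)
           (\<lambda>x. F'' (f x) * (norm (g x))\<^sup>2 + F' (f x) * L x)"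
  unfolding laplace_on_def
proof (intro ballI conjI)
  fix x assume x: "x \<in> S"
  obtain H where H: "(g has_derivative H) (at x)" "(\<Sum>i\<in>Basis. H i \<bullet> i) = L x"
    using assms x unfolding laplace_on_def by blast
  have f: "(f has_derivative (\<lambda>h. g x \<bullet> h)) (at x)"
    using assms x unfolding laplace_on_def by auto
  have comp: "((\<lambda>x. G (f x)) has_derivative (\<lambda>h. G' * (g x \<bullet> h))) (at x)"
    if "(G has_real_derivative G') (at (f x))" for G G'
    using has_derivative_compose[OF f, of G "(*) G'"] that
    by (simp add: has_field_derivative_def)
  show "((\<lambda>x. F (f x)) has_derivative (\<lambda>h. (F' (f x) *\<^sub>R g x) \<bullet> h)) (at x)"
    using comp[OF F(1)] by simp
  have "((\<lambda>x. F' (f x) *\<^sub>R g x) has_derivative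
     (\<lambda>h. F' (f x) *\<^sub>R H h + (F'' (f x) * (g x \<bullet> h)) *\<^sub>R g x)) (at x)"
    by (rule has_derivative_scaleR[OF comp[OF F(2)] H(1)])
  moreover have "(\<Sum>i\<in>Basis. (F' (f x) *\<^sub>R H i + (F'' (f x) * (g x \<bullet> i)) *\<^sub>R g x) \<bullet> i)
     = F'' (f x) * (norm (g x))\<^sup>2 + F' (f x) * L x"
    by (simp add: inner_add_left sum.distrib H(2)[symmetric] sum_distrib_left
        power2_norm_eq_inner euclidean_inner[of "g x" "g x"] algebra_simps)
  ultimately show "\<exists>H. ((\<lambda>x. F' (f x) *\<^sub>R g x) has_derivative H) (at x) \<and>
      (\<Sum>i\<in>Basis. H i \<bullet> i) = F'' (f x) * (norm (g x))\<^sup>2 + F' (f x) * L x"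
    by blast
qed

lemma laplace_on_inner: "laplace_on S (\<lambda>x. b \<bullet> x) (\<lambda>x. b) (\<lambda>x. 0)"
  unfolding laplace_on_def
  by (auto intro!: derivative_eq_intros exI[of _ "\<lambda>h. 0"])

lemma laplace_on_norm2:
  fixes q :: "'a::euclidean_space"
  shows "laplace_on S (\<lambda>x. (norm (x - q))\<^sup>2) (\<lambda>x. 2 *\<^sub>R (x - q)) (\<lambda>x. 2 * real DIM('a))"
  unfolding laplace_on_def power2_norm_eq_inner
proof (intro ballI conjI)
  fix x :: 'a
  show "((\<lambda>x. (x - q) \<bullet> (x - q)) has_derivative (\<lambda>h. (2 *\<^sub>R (x - q)) \<bullet> h)) (at x)"
    by (auto intro!: derivative_eq_intros simp: inner_commute)
  show "\<exists>H. ((\<lambda>x. 2 *\<^sub>R (x - q)) has_derivative H) (at x) \<and> (\<Sum>i\<in>Basis. H i \<bullet> i) = 2 * real DIM('a)"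
    by (intro exI[of _ "\<lambda>h. 2 *\<^sub>R h"]) (auto intro!: derivative_eq_intros)
qed

lemma laplace_on_sum:
  assumes "finite I" "\<And>i. i \<in> I \<Longrightarrow> laplace_on S (f i) (g i) (L i)"
  shows "laplace_on S (\<lambda>x. \<Sum>i\<in>I. f i x) (\<lambda>x. \<Sum>i\<in>I. g i x) (\<lambda>x. \<Sum>i\<in>I. L i x)"
  using assms by (induction I rule: finite_induct) (auto intro!: laplace_on_const laplace_on_add)

lemma laplace_on_Un:
  "laplace_on S f g L \<Longrightarrow> laplace_on T f g L \<Longrightarrow> laplace_on (S \<union> T) f g L"
  unfolding laplace_on_def by blast

lemma laplace_on_subset: "laplace_on T f g L \<Longrightarrow> S \<subseteq> T \<Longrightarrow> laplace_on S f g L"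
  unfolding laplace_on_def by blast

lemma laplace_on_cong:
  assumes "open S" "laplace_on S f g L" "\<And>x. x \<in> S \<Longrightarrow> f' x = f x" "\<And>x. x \<in> S \<Longrightarrow> g' x = g x"
    "\<And>x. x \<in> S \<Longrightarrow> L' x = L x"
  shows "laplace_on S f' g' L'"
  unfolding laplace_on_def
proof (intro ballI conjI)
  fix x assume x: "x \<in> S"
  obtain H where H: "(g has_derivative H) (at x)" "(\<Sum>i\<in>Basis. H i \<bullet> i) = L x"
    using assms x unfolding laplace_on_def by blast
  have f: "(f has_derivative (\<lambda>h. g x \<bullet> h)) (at x)"
    using assms x unfolding laplace_on_def by auto
  show "(f' has_derivative (\<lambda>h. g' x \<bullet> h)) (at x)"
    unfolding assms(4)[OF x]
    by (rule has_derivative_transform_within_open[OF f assms(1) x]) (simp add: assms)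
  have "(g' has_derivative H) (at x)"
    by (rule has_derivative_transform_within_open[OF H(1) assms(1) x]) (simp add: assms)
  then show "\<exists>H. (g' has_derivative H) (at x) \<and> (\<Sum>i\<in>Basis. H i \<bullet> i) = L' x"
    using H assms(5) x by auto
qed

lemma laplace_on_continuous: "laplace_on S f g L \<Longrightarrow> continuous_on S f"
  unfolding laplace_on_def
  by (meson continuous_at_imp_continuous_on has_derivative_continuous)

lemma laplace_on_min:
  assumes S: "open S" and f: "laplace_on S f g L" and x: "x \<in> S" and min: "\<And>y. y \<in> S \<Longrightarrow> f x \<le> f y"
  shows "L x \<ge> 0"
proof -
  obtain H where H: "(g has_derivative H) (at x)" "(\<Sum>i\<in>Basis. H i \<bullet> i) = L x"
    using f x unfolding laplace_on_def by blast
  obtain e where e: "e > 0" "ball x e \<subseteq> S" using S x openE by blast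
  have fd: "(f has_derivative (\<lambda>h. g y \<bullet> h)) (at y)" if "y \<in> S" for y
    using that f unfolding laplace_on_def by blast
  have g0: "(\<lambda>h. g x \<bullet> h) = (\<lambda>h. 0)"
    by (rule differential_zero_maxmin[OF x S fd[OF x]]) (use min in auto)
  have "H i \<bullet> i \<ge> 0" if i: "i \<in> Basis" for i
  proof (rule ccontr)
    assume neg: "\<not> 0 \<le> H i \<bullet> i"
    have line: "((\<lambda>s. x + s *\<^sub>R i) has_derivative (\<lambda>s. s *\<^sub>R i)) (at s)" for s
      by (auto intro!: derivative_eq_intros)
    have lin: "H (s *\<^sub>R i) = s *\<^sub>R H i" for s
      using has_derivative_bounded_linear[OF H(1)] by (simp add: linear_simps)
    have "((\<lambda>s. g (x + s *\<^sub>R i)) has_derivative (\<lambda>s. H (s *\<^sub>R i))) (at 0)"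
      using has_derivative_compose[OF line[of 0], of g H] H(1) by simp
    then have "((\<lambda>s. g (x + s *\<^sub>R i) \<bullet> i) has_derivative (\<lambda>s. H (s *\<^sub>R i) \<bullet> i)) (at 0)"
      by (auto intro!: derivative_eq_intros)
    then have D2: "((\<lambda>s. g (x + s *\<^sub>R i) \<bullet> i) has_real_derivative (H i \<bullet> i)) (at 0)"
      by (simp add: has_field_derivative_def lin mult_commute_abs)
    obtain d where d: "d > 0" "\<And>s. 0 < s \<Longrightarrow> s < d \<Longrightarrow> g (x + s *\<^sub>R i) \<bullet> i < g (x + 0 *\<^sub>R i) \<bullet> i"
      using DERIV_neg_dec_right[OF D2] neg by auto
    define s where "s = min d e / 2"
    have s: "s > 0" "s < d" "s < e" using d e by (auto simp: s_def)
    have ins: "x + r *\<^sub>R i \<in> S" if "0 \<le> r" "r \<le> s" for r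
      using that s i e(2) by (auto simp: subset_iff dist_norm)
    have D1: "((\<lambda>s. f (x + s *\<^sub>R i)) has_real_derivative (g (x + r *\<^sub>R i) \<bullet> i)) (at r)"
      if "0 \<le> r" "r \<le> s" for r
      using has_derivative_compose[OF line[of r] fd[OF ins[OF that]]]
      by (simp add: has_field_derivative_def mult_commute_abs)
    obtain r where r: "0 < r" "r < s" "f (x + s *\<^sub>R i) - f (x + 0 *\<^sub>R i) = (s - 0) * (g (x + r *\<^sub>R i) \<bullet> i)"
      using MVT2[OF s(1) D1] by auto
    have "g (x + r *\<^sub>R i) \<bullet> i < 0"
      using d(2)[of r] r s fun_cong[OF g0, of i] by auto
    then have "f (x + s *\<^sub>R i) < f x" using r(3) s mult_pos_neg[of s "g (x + r *\<^sub>R i) \<bullet> i"] by simp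
    then show False using min[OF ins[of s]] s by auto
  qed
  then show ?thesis unfolding H(2)[symmetric] by (rule sum_nonneg)
qed

lemma has_real_derivative_max0_power:
  assumes "n \<ge> 2"
  shows "((\<lambda>r::real. (max 0 r)^n) has_real_derivative n * (max 0 r)^(n-1)) (at r)"
proof -
  consider "r < 0" | "r > 0" | "r = 0" by linarith
  then show ?thesis
  proof cases
    case 1
    have "((\<lambda>r::real. 0) has_real_derivative n * (max 0 r)^(n-1)) (at r)"
      using 1 assms by (auto intro!: derivative_eq_intros)
    then show ?thesis
      by (rule has_field_derivative_transform_within_open[of _ _ _ "{..<0}"]) (use 1 assms in auto)
  next
    case 2
    have "((\<lambda>r::real. r^n) has_real_derivative n * (max 0 r)^(n-1)) (at r)"
      using 2 by (auto intro!: derivative_eq_intros)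
    then show ?thesis
      by (rule has_field_derivative_transform_within_open[of _ _ _ "{0<..}"]) (use 2 in auto)
  next
    case 3
    have "((\<lambda>h::real. (max 0 h)^n / h) \<longlongrightarrow> 0) (at 0)"
    proof (rule Lim_null_comparison)
      show "\<forall>\<^sub>F h in at 0. norm ((max 0 h)^n / h :: real) \<le> \<bar>h\<bar>^(n-1)"
      proof (intro always_eventually allI)
        fix h :: real
        show "norm ((max 0 h)^n / h) \<le> \<bar>h\<bar>^(n-1)"
          using assms by (cases n; cases "h > 0") (auto simp: max_def)
      qed
      show "((\<lambda>h::real. \<bar>h\<bar>^(n-1)) \<longlongrightarrow> 0) (at 0)"
        using assms by (auto intro!: tendsto_eq_intros)
    qed
    then show ?thesis using 3 assms unfolding DERIV_def by (simp add: power_0_left)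
  qed
qed

lemma laplace_on_max0_cube:
  assumes "laplace_on S f g L"
  shows "laplace_on S (\<lambda>x. (max 0 (f x))^3) (\<lambda>x. (3 * (max 0 (f x))\<^sup>2) *\<^sub>R g x)
           (\<lambda>x. 6 * max 0 (f x) * (norm (g x))\<^sup>2 + 3 * (max 0 (f x))\<^sup>2 * L x)"
proof (rule laplace_on_compose[OF assms])
  show "((\<lambda>r. (max 0 r)^3) has_real_derivative 3 * (max 0 r)\<^sup>2) (at r)" for r :: real
    using has_real_derivative_max0_power[of 3 r] by simp
  show "((\<lambda>r. 3 * (max 0 r)\<^sup>2) has_real_derivative 6 * max 0 r) (at r)" for r :: real
    using DERIV_cmult[OF has_real_derivative_max0_power[of 2 r], of 3] by simp
qed

section \<open>A barrier for the Neumann condition\<close>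

lemma line_derivative:
  fixes f :: "'a::real_inner \<Rightarrow> real"
  assumes "(f has_derivative (\<lambda>h. g \<bullet> h)) (at p)"
  shows "((\<lambda>s. f (p + s *\<^sub>R h)) has_real_derivative g \<bullet> h) (at 0)"
proof -
  have "((\<lambda>s. p + s *\<^sub>R h) has_derivative (\<lambda>s. s *\<^sub>R h)) (at 0)"
    by (auto intro!: derivative_eq_intros)
  from has_derivative_compose[OF this, of f "\<lambda>h. g \<bullet> h"] assms show ?thesis
    by (simp add: has_field_derivative_def mult_commute_abs)
qed

lemma defining_function_decreases:
  assumes "(\<rho> has_derivative (\<lambda>h. g \<bullet> h)) (at p)" "g \<bullet> h < 0" "\<rho> p = (0::real)"
  obtains d where "d > 0" "\<And>s. 0 < s \<Longrightarrow> s < d \<Longrightarrow> \<rho> (p + s *\<^sub>R h) < 0"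
  using DERIV_neg_dec_right[OF line_derivative[OF assms(1)] assms(2)] assms(3) that by auto

lemma defining_function_frontier:
  assumes "open \<Omega>" "local_C2_defining \<Omega> p r \<rho> g" "y \<in> frontier \<Omega>" "y \<in> ball p r"
  shows "\<rho> y = 0"
proof -
  have eq: "\<Omega> \<inter> ball p r = {x \<in> ball p r. \<rho> x < 0}"
    and cont: "isCont \<rho> y"
    using assms unfolding local_C2_defining_def by (auto dest: has_derivative_continuous)
  have "y \<notin> \<Omega>" "y \<in> closure \<Omega>"
    using assms by (auto simp: frontier_def interior_open)
  then have "\<not> \<rho> y < 0" using eq assms by auto
  moreover have "\<not> \<rho> y > 0"
  proof
    assume "\<rho> y > 0"
    then have "eventually (\<lambda>x. \<rho> x > 0) (nhds y)"
      using cont by (auto simp: isCont_def tendsto_nhds_iff intro: order_tendstoD)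
    moreover have "eventually (\<lambda>x. x \<in> ball p r) (nhds y)"
      using assms by (intro eventually_nhds_in_open) auto
    ultimately have "eventually (\<lambda>x. \<rho> x > 0 \<and> x \<in> ball p r) (nhds y)"
      by eventually_elim auto
    then obtain S where S: "open S" "y \<in> S" "\<And>x. x \<in> S \<Longrightarrow> \<rho> x > 0 \<and> x \<in> ball p r"
      unfolding eventually_nhds by blast
    then obtain x where "x \<in> S" "x \<in> \<Omega>"
      using \<open>y \<in> closure \<Omega>\<close> by (meson closure_iff_nhds_not_empty disjoint_iff subset_refl)
    then show False using S(3)[of x] eq by force
  qed
  ultimately show ?thesis by linarith
qed

lemma local_C2_defining_shift:
  assumes "local_C2_defining \<Omega> p r \<rho> g" "y \<in> ball p r"
  shows "local_C2_defining \<Omega> y (r - dist p y) \<rho> g"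
proof -
  have sub: "ball y (r - dist p y) \<subseteq> ball p r"
  proof
    fix x assume "x \<in> ball y (r - dist p y)"
    then show "x \<in> ball p r" using dist_triangle[of p x y] by auto
  qed
  obtain G where G: "\<forall>x\<in>ball p r. (\<rho> has_derivative (\<lambda>h. g x \<bullet> h)) (at x)
      \<and> (g has_derivative G x) (at x) \<and> g x \<noteq> 0" "\<forall>h. continuous_on (ball p r) (\<lambda>x. G x h)"
    and eq: "\<Omega> \<inter> ball p r = {x \<in> ball p r. \<rho> x < 0}"
    using assms(1) unfolding local_C2_defining_def by blast
  have "\<Omega> \<inter> ball y (r - dist p y) = {x \<in> ball y (r - dist p y). \<rho> x < 0}"
    using sub eq by blast
  moreover have "\<forall>h. continuous_on (ball y (r - dist p y)) (\<lambda>x. G x h)"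
    using G(2) sub continuous_on_subset by blast
  ultimately show ?thesis
    using G(1) sub assms(2) unfolding local_C2_defining_def by (intro conjI exI[of _ G]) auto
qed

lemma local_C2_defining_parallel:
  assumes "open \<Omega>" "p \<in> frontier \<Omega>"
    and "local_C2_defining \<Omega> p r \<rho> g" "local_C2_defining \<Omega> p r' \<rho>' g'"
  shows "g p \<bullet> g' p > 0"
proof (rule ccontr)
  assume neg: "\<not> g p \<bullet> g' p > 0"
  have r: "r > 0" "r' > 0" and g: "g p \<noteq> 0" "g' p \<noteq> 0"
    and d: "(\<rho> has_derivative (\<lambda>h. g p \<bullet> h)) (at p)" "(\<rho>' has_derivative (\<lambda>h. g' p \<bullet> h)) (at p)"
    and eq: "\<Omega> \<inter> ball p r = {x \<in> ball p r. \<rho> x < 0}" "\<Omega> \<inter> ball p r' = {x \<in> ball p r'. \<rho>' x < 0}"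
    using assms(3,4) unfolding local_C2_defining_def by auto
  have z: "\<rho> p = 0" "\<rho>' p = 0"
    using defining_function_frontier[OF assms(1) assms(3) assms(2)]
      defining_function_frontier[OF assms(1) assms(4) assms(2)] r by auto
  define h where "h = g' p - g p"
  have gh: "g p \<bullet> h < 0" and g'h: "g' p \<bullet> h > 0"
  proof -
    have "g p \<bullet> g p > 0" "g' p \<bullet> g' p > 0" using g by auto
    moreover have "g' p \<bullet> g p \<le> 0" using neg by (simp add: inner_commute)
    ultimately show "g p \<bullet> h < 0" "g' p \<bullet> h > 0"
      using neg unfolding h_def inner_diff_right by linarith+
  qed
  obtain a where a: "a > 0" "\<And>s. 0 < s \<Longrightarrow> s < a \<Longrightarrow> \<rho> (p + s *\<^sub>R h) < 0"
    by (rule defining_function_decreases[OF d(1) gh z(1)]) (rule that; blast)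
  obtain b where b: "b > 0" "\<And>s. 0 < s \<Longrightarrow> s < b \<Longrightarrow> \<rho>' (p + s *\<^sub>R h) > \<rho>' (p + 0 *\<^sub>R h)"
    using DERIV_pos_inc_right[OF line_derivative[OF d(2)] g'h] by auto
  have pos: "norm h + 1 > 0" by (simp add: add_nonneg_pos)
  define m where "m = min (min a b) (min (r / (norm h + 1)) (r' / (norm h + 1)))"
  define s where "s = m / 2"
  have "m > 0" "m \<le> a" "m \<le> b" "m \<le> r / (norm h + 1)" "m \<le> r' / (norm h + 1)"
    using a(1) b(1) r pos by (simp_all add: m_def)
  then have s: "s > 0" "s < a" "s < b" "s < r / (norm h + 1)" "s < r' / (norm h + 1)"
    unfolding s_def by linarith+
  have "s * norm h < r" "s * norm h < r'"
    using s pos by (auto simp: pos_less_divide_eq distrib_left)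
  then have "p + s *\<^sub>R h \<in> ball p r" "p + s *\<^sub>R h \<in> ball p r'"
    using s by (auto simp: dist_norm)
  moreover have "\<rho> (p + s *\<^sub>R h) < 0" "\<rho>' (p + s *\<^sub>R h) > 0"
    using a(2)[of s] b(2)[of s] s z by auto
  ultimately show False using eq by (smt (verit) Int_iff mem_Collect_eq)
qed

lemma local_barrier:
  assumes "open \<Omega>" "local_C2_defining \<Omega> p r \<rho> g"
  obtains \<psi> h L C where "laplace_on UNIV \<psi> h L" "\<And>x. \<bar>\<psi> x\<bar> \<le> C" "\<And>x. \<bar>L x\<bar> \<le> C"
    "\<And>y r' \<rho>' g'. y \<in> frontier \<Omega> \<Longrightarrow> local_C2_defining \<Omega> y r' \<rho>' g' \<Longrightarrow>
        h y \<bullet> g' y \<ge> 0 \<and> (y \<in> ball p (r/2) \<longrightarrow> h y \<bullet> g' y > 0)"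
proof -
  obtain G where G: "\<And>x. x \<in> ball p r \<Longrightarrow> (\<rho> has_derivative (\<lambda>h. g x \<bullet> h)) (at x)"
      "\<And>x. x \<in> ball p r \<Longrightarrow> (g has_derivative G x) (at x)" "\<And>h. continuous_on (ball p r) (\<lambda>x. G x h)"
    and r: "r > 0"
    using assms(2) unfolding local_C2_defining_def by blast
  define LR where "LR = (\<lambda>x. \<Sum>i\<in>Basis. G x i \<bullet> i)"
  have R: "laplace_on (ball p r) \<rho> g LR"
    unfolding laplace_on_def LR_def using G(1,2) by blast
  define f where "f = (\<lambda>x. r\<^sup>2/4 + (-1) * (norm (x - p))\<^sup>2)"
  define \<eta> where "\<eta> = (\<lambda>x. (max 0 (f x))^3)"
  define gf where "gf = (\<lambda>x. (0::'a) + (-1) *\<^sub>R (2 *\<^sub>R (x - p)))"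
  define gc where "gc = (\<lambda>x. (3 * (max 0 (f x))\<^sup>2) *\<^sub>R gf x)"
  define Lc where "Lc = (\<lambda>x. 6 * max 0 (f x) * (norm (gf x))\<^sup>2
      + 3 * (max 0 (f x))\<^sup>2 * (0 + (-1) * (2 * real DIM('a))))"
  have c: "laplace_on UNIV \<eta> gc Lc"
    unfolding \<eta>_def gc_def Lc_def f_def gf_def
    by (intro laplace_on_max0_cube laplace_on_add laplace_on_const laplace_on_cmult laplace_on_norm2)
  define gp where "gp = (\<lambda>x. \<eta> x *\<^sub>R g x + \<rho> x *\<^sub>R gc x)"
  define Lp where "Lp = (\<lambda>x. \<eta> x * LR x + \<rho> x * Lc x + 2 * (gc x \<bullet> g x))"
  have prod: "laplace_on (ball p r) (\<lambda>x. \<eta> x * \<rho> x) gp Lp"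
    unfolding gp_def Lp_def
    by (rule laplace_on_mult[OF laplace_on_subset[OF c] R]) auto
  define \<psi> where "\<psi> = (\<lambda>x. if x \<in> ball p r then \<eta> x * \<rho> x else 0)"
  define h where "h = (\<lambda>x. if x \<in> ball p r then gp x else 0)"
  define L where "L = (\<lambda>x. if x \<in> ball p r then Lp x else 0)"
  have far: "max 0 (f x) = 0" if "x \<notin> ball p (r/2)" for x
  proof -
    have "r/2 \<le> norm (x - p)" using that by (auto simp: dist_norm norm_minus_commute)
    then have "(r/2)^2 \<le> (norm (x - p))^2" by (rule power_mono) (use r in auto)
    then show ?thesis by (auto simp: f_def power_divide)
  qed
  have near: "f x > 0" if "x \<in> ball p (r/2)" for x
  proof -
    have "norm (x - p) < r/2" using that by (auto simp: dist_norm norm_minus_commute)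
    then have "(norm (x - p))^2 < (r/2)^2" by (rule power_strict_mono) auto
    then show ?thesis by (auto simp: f_def power_divide)
  qed
  have zero: "\<psi> x = 0" "h x = 0" "L x = 0" if "x \<notin> ball p (r/2)" for x
    using far[OF that] by (auto simp: \<psi>_def h_def L_def \<eta>_def gp_def Lp_def gc_def Lc_def)
  have l1: "laplace_on (ball p r) \<psi> h L"
    by (rule laplace_on_cong[OF _ prod]) (auto simp: \<psi>_def h_def L_def)
  have l2: "laplace_on (- cball p (r/2)) \<psi> h L"
    by (rule laplace_on_cong[OF _ laplace_on_const[of _ 0]]) (auto intro!: zero)
  have "ball p r \<union> - cball p (r/2) = UNIV" using r by auto
  then have lap: "laplace_on UNIV \<psi> h L" using laplace_on_Un[OF l1 l2] by simp
  have sub: "cball p (r/2) \<subseteq> ball p r" using r by auto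
  have cont: "continuous_on (ball p r) \<rho>" "continuous_on (ball p r) g" "continuous_on (ball p r) LR"
  proof -
    show "continuous_on (ball p r) \<rho>"
      by (rule has_derivative_continuous_on) (rule has_derivative_at_withinI[OF G(1)])
    show "continuous_on (ball p r) g"
      by (rule has_derivative_continuous_on) (rule has_derivative_at_withinI[OF G(2)])
    show "continuous_on (ball p r) LR"
      unfolding LR_def by (intro continuous_on_sum continuous_on_inner G(3) continuous_on_const)
  qed
  have contc: "continuous_on S \<eta>" "continuous_on S gc" "continuous_on S Lc" for S
    unfolding \<eta>_def gc_def Lc_def gf_def f_def by (auto intro!: continuous_intros)
  have "continuous_on (ball p r) (\<lambda>x. \<eta> x * \<rho> x)" "continuous_on (ball p r) Lp"
    unfolding Lp_def by (auto intro!: continuous_intros cont contc)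
  then have "compact ((\<lambda>x. \<eta> x * \<rho> x) ` cball p (r/2))" "compact (Lp ` cball p (r/2))"
    using sub by (auto intro!: compact_continuous_image intro: continuous_on_subset)
  then have "bounded ((\<lambda>x. \<eta> x * \<rho> x) ` cball p (r/2))" "bounded (Lp ` cball p (r/2))"
    by (auto intro: compact_imp_bounded)
  then obtain C1 C2 where C1: "\<forall>x\<in>cball p (r/2). norm (\<eta> x * \<rho> x) \<le> C1"
      and C2: "\<forall>x\<in>cball p (r/2). norm (Lp x) \<le> C2"
    unfolding bounded_iff ball_simps by blast
  define C where "C = max 0 (max C1 C2)"
  have b: "\<bar>\<psi> x\<bar> \<le> C" "\<bar>L x\<bar> \<le> C" for x
  proof -
    have "\<bar>\<psi> x\<bar> \<le> C \<and> \<bar>L x\<bar> \<le> C"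
    proof (cases "x \<in> ball p (r/2)")
      case True
      then have x: "x \<in> cball p (r/2)" "x \<in> ball p r" using r by auto
      have "\<bar>\<eta> x * \<rho> x\<bar> \<le> C" "\<bar>Lp x\<bar> \<le> C"
        using bspec[OF C1 x(1)] bspec[OF C2 x(1)] unfolding C_def real_norm_def by linarith+
      then show ?thesis using x(2) by (simp add: \<psi>_def L_def)
    next
      case False
      then show ?thesis using zero[OF False] by (simp add: C_def)
    qed
    then show "\<bar>\<psi> x\<bar> \<le> C" "\<bar>L x\<bar> \<le> C" by auto
  qed
  show thesis
  proof (rule that[OF lap b])
    fix y r' \<rho>' g' assume y: "y \<in> frontier \<Omega>" "local_C2_defining \<Omega> y r' \<rho>' g'"
    show "h y \<bullet> g' y \<ge> 0 \<and> (y \<in> ball p (r/2) \<longrightarrow> h y \<bullet> g' y > 0)"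
    proof (cases "y \<in> ball p (r/2)")
      case True
      then have yr: "y \<in> ball p r" using r by auto
      have "\<rho> y = 0" by (rule defining_function_frontier[OF assms y(1) yr])
      then have hy: "h y = \<eta> y *\<^sub>R g y" using yr by (simp add: h_def gp_def)
      have "g y \<bullet> g' y > 0"
        by (rule local_C2_defining_parallel[OF assms(1) y(1) local_C2_defining_shift[OF assms(2) yr] y(2)])
      then show ?thesis using near[OF True] by (auto simp: hy \<eta>_def)
    next
      case False
      then show ?thesis using zero(2)[OF False] by simp
    qed
  qed
qed

lemma frontier_barrier:
  assumes "open \<Omega>" "compact (frontier \<Omega>)" "C2_domain \<Omega>"
  obtains \<psi> h L C where "laplace_on UNIV \<psi> h L" "\<And>x. \<bar>\<psi> x\<bar> \<le> C" "\<And>x. \<bar>L x\<bar> \<le> C"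
    "\<And>y r' \<rho>' g'. y \<in> frontier \<Omega> \<Longrightarrow> local_C2_defining \<Omega> y r' \<rho>' g' \<Longrightarrow> h y \<bullet> g' y > 0"
proof -
  have "\<exists>q. \<forall>p\<in>frontier \<Omega>. local_C2_defining \<Omega> p (fst (q p)) (fst (snd (q p))) (snd (snd (q p)))"
    using assms(3) unfolding C2_domain_def by (intro bchoice) auto
  then obtain r \<rho> g where q: "\<And>p. p \<in> frontier \<Omega> \<Longrightarrow> local_C2_defining \<Omega> p (r p) (\<rho> p) (g p)"
    by (metis comp_apply)
  have "\<forall>p\<in>frontier \<Omega>. \<exists>\<psi> h L C. laplace_on UNIV \<psi> h L \<and> (\<forall>x. \<bar>\<psi> x\<bar> \<le> C) \<and> (\<forall>x. \<bar>L x\<bar> \<le> C) \<and>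
    (\<forall>y r' \<rho>' g'. y \<in> frontier \<Omega> \<longrightarrow> local_C2_defining \<Omega> y r' \<rho>' g' \<longrightarrow>
        h y \<bullet> g' y \<ge> 0 \<and> (y \<in> ball p (r p/2) \<longrightarrow> h y \<bullet> g' y > 0))"
    using local_barrier[OF assms(1) q] by (metis (no_types, lifting))
  then obtain \<psi> h L C where P: "\<And>p. p \<in> frontier \<Omega> \<Longrightarrow> laplace_on UNIV (\<psi> p) (h p) (L p)"
     "\<And>p x. p \<in> frontier \<Omega> \<Longrightarrow> \<bar>\<psi> p x\<bar> \<le> C p" "\<And>p x. p \<in> frontier \<Omega> \<Longrightarrow> \<bar>L p x\<bar> \<le> C p"
     "\<And>p y r' \<rho>' g'. p \<in> frontier \<Omega> \<Longrightarrow> y \<in> frontier \<Omega> \<Longrightarrow> local_C2_defining \<Omega> y r' \<rho>' g' \<Longrightarrow>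
        h p y \<bullet> g' y \<ge> 0 \<and> (y \<in> ball p (r p/2) \<longrightarrow> h p y \<bullet> g' y > 0)"
    by metis
  have r: "r p > 0" if "p \<in> frontier \<Omega>" for p
    using q[OF that] unfolding local_C2_defining_def by auto
  have "frontier \<Omega> \<subseteq> (\<Union>p\<in>frontier \<Omega>. ball p (r p/2))" using r by force
  then obtain I where I: "I \<subseteq> frontier \<Omega>" "finite I" "frontier \<Omega> \<subseteq> (\<Union>p\<in>I. ball p (r p/2))"
    using compactE_image[OF assms(2), of "frontier \<Omega>" "\<lambda>p. ball p (r p/2)"] by auto
  show thesis
  proof (rule that)
    show "laplace_on UNIV (\<lambda>x. \<Sum>p\<in>I. \<psi> p x) (\<lambda>x. \<Sum>p\<in>I. h p x) (\<lambda>x. \<Sum>p\<in>I. L p x)"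
      by (rule laplace_on_sum[OF I(2)]) (use P(1) I(1) in auto)
    show "\<bar>\<Sum>p\<in>I. \<psi> p x\<bar> \<le> (\<Sum>p\<in>I. C p)" for x
      using I(1) by (intro order.trans[OF sum_abs] sum_mono P(2)) auto
    show "\<bar>\<Sum>p\<in>I. L p x\<bar> \<le> (\<Sum>p\<in>I. C p)" for x
      using I(1) by (intro order.trans[OF sum_abs] sum_mono P(3)) auto
    fix y r' \<rho>' g' assume y: "y \<in> frontier \<Omega>" "local_C2_defining \<Omega> y r' \<rho>' g'"
    then obtain p where p: "p \<in> I" "y \<in> ball p (r p/2)" using I by blast
    have "(\<Sum>p\<in>I. h p y \<bullet> g' y) > 0"
      by (rule sum_pos2[OF I(2) p(1)]) (use P(4) y I(1) p in blast)+
    then show "(\<Sum>p\<in>I. h p y) \<bullet> g' y > 0" by (simp add: inner_sum_left)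
  qed
qed

lemma exterior_domain_frontier:
  assumes "exterior_domain \<Omega>"
  obtains R where "R > 0" "\<And>x. x \<notin> \<Omega> \<Longrightarrow> norm x < R" "\<And>x. x \<in> frontier \<Omega> \<Longrightarrow> norm x < R" "compact (frontier \<Omega>)"
proof -
  have o: "open \<Omega>" and c: "compact (- \<Omega>)" using assms by (auto simp: exterior_domain_def)
  obtain R where R: "R > 0" "\<And>x. x \<in> - \<Omega> \<Longrightarrow> norm x < R"
    using compact_imp_bounded[OF c] by (auto simp: bounded_pos_less)
  have "frontier \<Omega> \<subseteq> - \<Omega>" using o by (auto simp: frontier_def interior_open)
  moreover from this have "compact (frontier \<Omega>)"
    using c compact_imp_bounded bounded_subset by (metis compact_frontier_bounded frontier_complement)
  ultimately show thesis using that R by blast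
qed

lemma neumann_barrier:
  fixes \<Omega> :: "'a::euclidean_space set"
  assumes "exterior_domain \<Omega>" "C2_domain \<Omega>"
  obtains \<Phi> h L K where "laplace_on UNIV \<Phi> h L" "\<And>x. \<Phi> x \<ge> 1" "K > 0" "\<And>x. L x \<le> K * \<Phi> x"
    "\<And>M. \<exists>R. \<forall>x. norm x \<ge> R \<longrightarrow> \<Phi> x \<ge> M"
    "\<And>y r \<rho> g. y \<in> frontier \<Omega> \<Longrightarrow> local_C2_defining \<Omega> y r \<rho> g \<Longrightarrow> h y \<bullet> g y > 0"
proof -
  obtain R where R: "R > 0" "\<And>x. x \<notin> \<Omega> \<Longrightarrow> norm x < R"
      "\<And>x. x \<in> frontier \<Omega> \<Longrightarrow> norm x < R" "compact (frontier \<Omega>)"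
    by (rule exterior_domain_frontier[OF assms(1)]) (rule that; blast)
  have o: "open \<Omega>" using assms(1) by (auto simp: exterior_domain_def)
  obtain \<psi> h L C where P: "laplace_on UNIV \<psi> h L" "\<And>x. \<bar>\<psi> x\<bar> \<le> C" "\<And>x. \<bar>L x\<bar> \<le> C"
    "\<And>y r' \<rho>' g'. y \<in> frontier \<Omega> \<Longrightarrow> local_C2_defining \<Omega> y r' \<rho>' g' \<Longrightarrow> h y \<bullet> g' y > 0"
    by (rule frontier_barrier[OF o R(4) assms(2)]) (rule that, assumption, blast+)
  have C: "C \<ge> 0" using P(2)[of 0] by linarith
  define f where "f = (\<lambda>x::'a. (norm (x - 0))\<^sup>2 + (- R\<^sup>2))"
  define s where "s = (\<lambda>x. max 0 (f x))"
  define gs where "gs = (\<lambda>x. (3 * (s x)\<^sup>2) *\<^sub>R (2 *\<^sub>R (x - 0) + 0))"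
  define Ls where "Ls = (\<lambda>x::'a. 6 * s x * (norm (2 *\<^sub>R (x - 0) + 0))\<^sup>2 + 3 * (s x)\<^sup>2 * (2 * real DIM('a) + 0))"
  have ls: "laplace_on UNIV (\<lambda>x. s x ^ 3) gs Ls"
    unfolding s_def gs_def Ls_def f_def
    by (intro laplace_on_max0_cube laplace_on_add laplace_on_const laplace_on_norm2)
  define \<Phi> where "\<Phi> = (\<lambda>x. (1 + C) + (\<psi> x + s x ^ 3))"
  have lap: "laplace_on UNIV \<Phi> (\<lambda>x. 0 + (h x + gs x)) (\<lambda>x. 0 + (L x + Ls x))"
    unfolding \<Phi>_def by (intro laplace_on_add laplace_on_const P(1) ls)
  have s0: "s x \<ge> 0" for x by (simp add: s_def)
  have Phi: "\<Phi> x \<ge> 1 + s x ^ 3" for x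
    using P(2)[of x] by (simp add: \<Phi>_def)
  define K where "K = C + (24 + 24 * R\<^sup>2 + 6 * real DIM('a))"
  have LK: "0 + (L x + Ls x) \<le> K * \<Phi> x" for x
  proof -
    have "s x * (norm x)\<^sup>2 \<le> s x * (s x + R\<^sup>2)"
      by (rule mult_left_mono) (auto simp: s_def f_def)
    then have "Ls x \<le> 24 * (s x)\<^sup>2 + 24 * R\<^sup>2 * s x + 6 * real DIM('a) * (s x)\<^sup>2"
      by (simp add: Ls_def power_mult_distrib power2_eq_square algebra_simps)
    also have "\<dots> \<le> 24 * (1 + s x ^ 3) + 24 * R\<^sup>2 * (1 + s x ^ 3) + 6 * real DIM('a) * (1 + s x ^ 3)"
    proof -
      have "(s x)\<^sup>2 \<le> 1 + s x ^ 3" "s x \<le> 1 + s x ^ 3"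
      proof -
        show "(s x)\<^sup>2 \<le> 1 + s x ^ 3" "s x \<le> 1 + s x ^ 3"
          using s0[of x] power_increasing[of 2 3 "s x"] power_increasing[of 1 3 "s x"]
            power_le_one[of "s x" 2] zero_le_power[of "s x" 3]
          by (cases "s x \<ge> 1"; simp; linarith)+
      qed
      then show ?thesis by (intro add_mono mult_left_mono) auto
    qed
    also have "\<dots> = (24 + 24 * R\<^sup>2 + 6 * real DIM('a)) * (1 + s x ^ 3)" by (simp add: algebra_simps)
    finally have "Ls x \<le> (24 + 24 * R\<^sup>2 + 6 * real DIM('a)) * (1 + s x ^ 3)" .
    moreover have "L x \<le> C * (1 + s x ^ 3)"
      using P(3)[of x] mult_left_mono[of 1 "1 + s x ^ 3" C] s0[of x] C by auto
    ultimately have "0 + (L x + Ls x) \<le> K * (1 + s x ^ 3)" by (simp add: K_def distrib_right)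
    also have "\<dots> \<le> K * \<Phi> x"
      by (rule mult_left_mono[OF Phi]) (simp add: K_def C)
    finally show ?thesis .
  qed
  have coer: "\<exists>R'. \<forall>x. norm x \<ge> R' \<longrightarrow> \<Phi> x \<ge> M" for M
  proof (intro exI allI impI)
    fix x :: 'a assume x: "R + 1 + \<bar>M\<bar> \<le> norm x"
    have "(R + 1 + \<bar>M\<bar>)\<^sup>2 \<le> (norm x)\<^sup>2" by (rule power_mono[OF x]) (use R in auto)
    moreover have "(R + 1 + \<bar>M\<bar>)\<^sup>2 \<ge> R\<^sup>2 + (1 + \<bar>M\<bar>)"
    proof -
      have "(R + 1 + \<bar>M\<bar>)\<^sup>2 = R\<^sup>2 + (1 + \<bar>M\<bar>) + (2 * R * (1 + \<bar>M\<bar>) + \<bar>M\<bar> * (1 + \<bar>M\<bar>))"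
        by (simp add: power2_eq_square algebra_simps)
      then show ?thesis using R by simp
    qed
    ultimately have "s x \<ge> 1 + \<bar>M\<bar>" by (simp add: s_def f_def)
    then have "s x ^ 3 \<ge> 1 + \<bar>M\<bar>" using power_increasing[of 1 3 "s x"] by (simp; linarith)
    then show "\<Phi> x \<ge> M" using Phi[of x] by linarith
  qed
  show thesis
  proof (rule that[OF lap _ _ LK coer])
    show "1 \<le> \<Phi> x" for x using Phi[of x] zero_le_power[OF s0, of x 3] by linarith
    show "K > 0" using C by (simp add: K_def add_nonneg_pos add_pos_nonneg)
    fix y r \<rho> g assume y: "y \<in> frontier \<Omega>" "local_C2_defining \<Omega> y r \<rho> g"
    have "(norm y)\<^sup>2 \<le> R\<^sup>2" using R(3)[OF y(1)] by (intro power_mono) auto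
    then have "gs y = 0" by (simp add: gs_def s_def f_def)
    then show "(0 + (h y + gs y)) \<bullet> g y > 0" using P(4)[OF y] by simp
  qed
qed

section \<open>The comparison principle\<close>

lemma classical_neumann_eqD:
  assumes "classical_neumann_eq \<Omega> d f z"
  obtains zt gz Lz where
    "\<And>t x. t > 0 \<Longrightarrow> x \<in> \<Omega> \<Longrightarrow> ((\<lambda>s. z s x) has_real_derivative zt t x) (at t)"
    "\<And>t. t > 0 \<Longrightarrow> laplace_on \<Omega> (z t) (gz t) (Lz t)"
    "\<And>t x. t > 0 \<Longrightarrow> x \<in> \<Omega> \<Longrightarrow> zt t x = d * Lz t x + f t x"
proof -
  obtain zt gz Hz where H: "\<And>t x. t > 0 \<Longrightarrow> x \<in> \<Omega> \<Longrightarrow>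
            ((\<lambda>s. z s x) has_real_derivative zt t x) (at t)
          \<and> (z t has_derivative (\<lambda>h. gz t x \<bullet> h)) (at x)
          \<and> (gz t has_derivative Hz t x) (at x)
          \<and> zt t x = d * (\<Sum>i\<in>Basis. Hz t x i \<bullet> i) + f t x"
    using assms unfolding classical_neumann_eq_def by blast
  show thesis
  proof (rule that[of zt gz "\<lambda>t x. \<Sum>i\<in>Basis. Hz t x i \<bullet> i"])
    show "laplace_on \<Omega> (z t) (gz t) (\<lambda>x. \<Sum>i\<in>Basis. Hz t x i \<bullet> i)" if "t > 0" for t
      unfolding laplace_on_def using H[OF that] by blast
  qed (use H in blast)+
qed

lemma classical_neumann_eq_uminus:
  assumes "classical_neumann_eq \<Omega> d f z"
  shows "classical_neumann_eq \<Omega> d (\<lambda>t x. - f t x) (\<lambda>t x. - z t x)"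
proof -
  obtain zt gz Hz where H: "\<forall>t>0. \<forall>x\<in>\<Omega>.
            ((\<lambda>s. z s x) has_real_derivative zt t x) (at t)
          \<and> (z t has_derivative (\<lambda>h. gz t x \<bullet> h)) (at x)
          \<and> (gz t has_derivative Hz t x) (at x)
          \<and> zt t x = d * (\<Sum>i\<in>Basis. Hz t x i \<bullet> i) + f t x"
      "continuous_on ({0<..} \<times> \<Omega>) (\<lambda>(t,x). zt t x)"
      "\<forall>h. continuous_on ({0<..} \<times> \<Omega>) (\<lambda>(t,x). Hz t x h)"
    and B: "\<forall>t>0. \<forall>p\<in>frontier \<Omega>. \<exists>D. (z t has_derivative D) (at p within closure \<Omega>)
          \<and> (\<forall>r \<rho> g. local_C2_defining \<Omega> p r \<rho> g \<longrightarrow> D (g p) = 0)"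
    using assms unfolding classical_neumann_eq_def by blast
  show ?thesis
    unfolding classical_neumann_eq_def
  proof (intro conjI exI[of _ "\<lambda>t x. - zt t x"] exI[of _ "\<lambda>t x. - gz t x"] exI[of _ "\<lambda>t x h. - Hz t x h"] allI impI ballI)
    fix t x assume tx: "(t::real) > 0" "x \<in> \<Omega>"
    show "((\<lambda>s. - z s x) has_real_derivative - zt t x) (at t)"
      using H(1) tx by (intro DERIV_minus) blast
    have "(z t has_derivative (\<lambda>h. gz t x \<bullet> h)) (at x)" using H(1) tx by auto
    from has_derivative_minus[OF this]
    show "((\<lambda>x. - z t x) has_derivative (\<lambda>h. - gz t x \<bullet> h)) (at x)" by simp
    show "((\<lambda>x. - gz t x) has_derivative (\<lambda>h. - Hz t x h)) (at x)"
      using H(1) tx by (intro has_derivative_minus) blast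
    show "- zt t x = d * (\<Sum>i\<in>Basis. - Hz t x i \<bullet> i) + - f t x"
      using H(1) tx by (simp add: sum_negf)
  next
    show "continuous_on ({0<..} \<times> \<Omega>) (\<lambda>(t, x). - zt t x)"
      using continuous_on_minus[OF H(2)] by (simp add: case_prod_unfold)
    show "continuous_on ({0<..} \<times> \<Omega>) (\<lambda>(t, x). - Hz t x h)" for h
      using continuous_on_minus[OF H(3)[rule_format, of h]] by (simp add: case_prod_unfold)
  next
    fix t p assume tp: "(t::real) > 0" "p \<in> frontier \<Omega>"
    obtain D where D: "(z t has_derivative D) (at p within closure \<Omega>)"
      "\<forall>r \<rho> g. local_C2_defining \<Omega> p r \<rho> g \<longrightarrow> D (g p) = 0"
      using B tp by blast
    show "\<exists>D. ((\<lambda>x. - z t x) has_derivative D) (at p within closure \<Omega>) \<and>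
        (\<forall>r \<rho> g. local_C2_defining \<Omega> p r \<rho> g \<longrightarrow> D (g p) = 0)"
      using D by (intro exI[of _ "\<lambda>h. - D h"]) (auto intro: has_derivative_minus)
  qed
qed

lemma inward_derivative_at_min:
  assumes "open \<Omega>" "p \<in> frontier \<Omega>" "local_C2_defining \<Omega> p r \<rho> g"
    and "(F has_derivative D) (at p within closure \<Omega>)"
    and "\<epsilon> > 0" "\<And>x. x \<in> closure \<Omega> \<Longrightarrow> dist x p < \<epsilon> \<Longrightarrow> F p \<le> (F x :: real)"
  shows "D (g p) \<le> 0"
proof -
  have r: "r > 0" and g: "g p \<noteq> 0"
    and d: "(\<rho> has_derivative (\<lambda>h. g p \<bullet> h)) (at p)"
    and eq: "\<Omega> \<inter> ball p r = {x \<in> ball p r. \<rho> x < 0}"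
    using assms(3) unfolding local_C2_defining_def by auto
  have z: "\<rho> p = 0" using defining_function_frontier[OF assms(1,3,2)] r by simp
  define h where "h = - g p"
  have "g p \<bullet> h < 0" using g by (simp add: h_def)
  then obtain a where a: "a > 0" "\<And>s. 0 < s \<Longrightarrow> s < a \<Longrightarrow> \<rho> (p + s *\<^sub>R h) < 0"
    by (rule defining_function_decreases[OF d _ z]) (rule that; blast)
  have nh: "norm h > 0" using g by (simp add: h_def)
  define b where "b = min a (min (r / norm h) (\<epsilon> / norm h))"
  have b: "b > 0" using a r nh assms(5) by (simp add: b_def)
  have ins: "p + s *\<^sub>R h \<in> closure \<Omega> \<and> dist (p + s *\<^sub>R h) p < \<epsilon>" if "0 < s" "s < b" for s
  proof -
    have "s < r / norm h" "s < \<epsilon> / norm h" "s < a" using that by (auto simp: b_def)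
    then have "s * norm h < r" "s * norm h < \<epsilon>" "\<rho> (p + s *\<^sub>R h) < 0"
      using nh that a by (auto simp: pos_less_divide_eq)
    then have "p + s *\<^sub>R h \<in> \<Omega> \<inter> ball p r" "dist (p + s *\<^sub>R h) p < \<epsilon>"
      using that unfolding eq by (auto simp: dist_norm)
    then show ?thesis using closure_subset by blast
  qed
  have pcl: "p \<in> closure \<Omega>" using assms(2) by (simp add: frontier_def)
  have lin: "D (s *\<^sub>R x) = s * D x" for s x
    using has_derivative_bounded_linear[OF assms(4)] by (simp add: linear_simps)
  have line: "((\<lambda>s. p + s *\<^sub>R h) has_derivative (\<lambda>s. s *\<^sub>R h)) (at 0 within {0..b/2})"
    by (auto intro!: derivative_eq_intros)
  have img: "(\<lambda>s. p + s *\<^sub>R h) ` {0..b/2} \<subseteq> closure \<Omega>"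
  proof
    fix y assume "y \<in> (\<lambda>s. p + s *\<^sub>R h) ` {0..b/2}"
    then obtain s where "y = p + s *\<^sub>R h" "0 \<le> s" "s < b" using b by force
    then show "y \<in> closure \<Omega>" using ins[of s] pcl by (cases "s = 0") auto
  qed
  have "((\<lambda>s. F (p + s *\<^sub>R h)) has_derivative (\<lambda>s. D (s *\<^sub>R h))) (at 0 within {0..b/2})"
    using has_derivative_in_compose[OF line, of F D] has_derivative_subset[OF assms(4) img] by simp
  then have "((\<lambda>s. F (p + s *\<^sub>R h)) has_real_derivative D h) (at 0 within {0..b/2})"
    by (simp add: has_field_derivative_def lin mult_commute_abs)
  then have "((\<lambda>s. (F (p + s *\<^sub>R h) - F p) / s) \<longlongrightarrow> D h) (at 0 within {0..b/2})"
    by (simp add: has_field_derivative_iff)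
  moreover have "eventually (\<lambda>s. (F (p + s *\<^sub>R h) - F p) / s \<ge> 0) (at 0 within {0..b/2})"
    unfolding eventually_at using b
  proof (intro exI[of _ b] conjI ballI impI)
    fix s assume s: "s \<in> {0..b/2}" "s \<noteq> 0 \<and> dist s 0 < b"
    then show "(F (p + s *\<^sub>R h) - F p) / s \<ge> 0"
      using assms(6)[of "p + s *\<^sub>R h"] ins[of s] by auto
  qed auto
  moreover have "at 0 within {0..b/2} \<noteq> bot"
    using b by (simp add: at_within_Icc_at_right)
  ultimately have "D h \<ge> 0" by (intro tendsto_lowerbound[of _ _ "at 0 within {0..b/2}"]) auto
  then show ?thesis using lin[of "-1" "g p"] by (simp add: h_def)
qed

lemma left_derivative_at_min:
  fixes F :: "real \<Rightarrow> real"
  assumes "(F has_real_derivative D) (at t)" "a < t" "\<And>s. a < s \<Longrightarrow> s < t \<Longrightarrow> F t \<le> F s"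
  shows "D \<le> 0"
proof (rule ccontr)
  assume "\<not> D \<le> 0"
  then obtain d where d: "d > 0" "\<And>h. 0 < h \<Longrightarrow> h < d \<Longrightarrow> F (t - h) < F t"
    using DERIV_pos_inc_left[OF assms(1)] by auto
  define h where "h = min d (t - a) / 2"
  have "0 < h" "h < d" "h < t - a" using d assms(2) by (auto simp: h_def)
  then show False using d(2)[of h] assms(3)[of "t - h"] by force
qed

text \<open>The barrier function turns all weak inequalities at a negative minimum
  into strict ones and confines the minimum to a compact set.\<close>
theorem neumann_comparison:
  fixes \<Omega> :: "'a::euclidean_space set" and w :: "real \<Rightarrow> 'a \<Rightarrow> real"
  assumes ext: "exterior_domain \<Omega>" and C2: "C2_domain \<Omega>" and d: "d > 0"
    and z: "classical_neumann_eq \<Omega> d f z"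
    and cz: "continuous_on ({0..} \<times> closure \<Omega>) (\<lambda>(t,x). z t x)"
    and t0: "0 \<le> t0"
    and cw: "continuous_on UNIV (\<lambda>(t,x). w t x)"
    and wt: "\<And>t x. ((\<lambda>s. w s x) has_real_derivative wt t x) (at t)"
    and lw: "\<And>t. laplace_on UNIV (w t) (gw t) (Lw t)"
    and bnd: "\<And>t x. t0 \<le> t \<Longrightarrow> t \<le> t1 \<Longrightarrow> x \<in> closure \<Omega> \<Longrightarrow> z t x - w t x \<ge> - B"
    and init: "\<And>x. x \<in> closure \<Omega> \<Longrightarrow> w t0 x \<le> z t0 x"
    and sub: "\<And>t x. t0 < t \<Longrightarrow> t \<le> t1 \<Longrightarrow> x \<in> \<Omega> \<Longrightarrow> z t x < w t x \<Longrightarrow>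
        f t x - (wt t x - d * Lw t x) \<ge> G * (z t x - w t x)"
    and bdry: "\<And>t p. t0 < t \<Longrightarrow> t \<le> t1 \<Longrightarrow> p \<in> frontier \<Omega> \<Longrightarrow> z t p < w t p \<Longrightarrow>
        \<exists>r \<rho> g. local_C2_defining \<Omega> p r \<rho> g \<and> gw t p \<bullet> g p \<le> 0"
    and tx: "t0 \<le> t" "t \<le> t1" "x \<in> closure \<Omega>"
  shows "w t x \<le> z t x"
proof (rule ccontr)
  assume "\<not> w t x \<le> z t x"
  then have lt: "z t x - w t x < 0" by simp
  have o: "open \<Omega>" using ext by (simp add: exterior_domain_def)
  obtain \<Phi> h L K where Phi: "laplace_on UNIV \<Phi> h L" "\<And>x. \<Phi> x \<ge> 1" "K > 0" "\<And>x. L x \<le> K * \<Phi> x"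
    "\<And>M. \<exists>R. \<forall>x. norm x \<ge> R \<longrightarrow> \<Phi> x \<ge> M"
    "\<And>y r \<rho> g. y \<in> frontier \<Omega> \<Longrightarrow> local_C2_defining \<Omega> y r \<rho> g \<Longrightarrow> h y \<bullet> g y > 0"
    by (rule neumann_barrier[OF ext C2]) (rule that, assumption, blast+)
  obtain zt gz Lz where Z:
    "\<And>t x. t > 0 \<Longrightarrow> x \<in> \<Omega> \<Longrightarrow> ((\<lambda>s. z s x) has_real_derivative zt t x) (at t)"
    "\<And>t. t > 0 \<Longrightarrow> laplace_on \<Omega> (z t) (gz t) (Lz t)"
    "\<And>t x. t > 0 \<Longrightarrow> x \<in> \<Omega> \<Longrightarrow> zt t x = d * Lz t x + f t x"
    by (rule classical_neumann_eqD[OF z]) (rule that, blast+)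
  define G' where "G' = max 0 G"
  define E where "E = (\<lambda>s. exp (- (G' * (s - t0))))"
  have Ep: "E s > 0" for s by (simp add: E_def)
  define k where "k = 1 + d * K"
  have k: "k > 0" using d Phi(3) by (simp add: k_def add_pos_pos)
  define \<eta> where "\<eta> = E t * (w t x - z t x) / (2 * exp (k * (t - t0)) * \<Phi> x)"
  have Phip: "\<Phi> y > 0" for y using Phi(2)[of y] by linarith
  have eta: "\<eta> > 0" unfolding \<eta>_def using lt Phip[of x] Ep[of t] by (intro divide_pos_pos mult_pos_pos) auto
  define q where "q = (\<lambda>s y. \<eta> * exp (k * (s - t0)) * \<Phi> y)"
  define W where "W = (\<lambda>s y. E s * (z s y - w s y) + q s y)"
  have qpos: "q s y > 0" for s y using eta Phip by (simp add: q_def)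
  have Wx: "W t x < 0"
  proof -
    have "q t x = E t * (w t x - z t x) / 2" using Phip[of x] by (simp add: q_def \<eta>_def)
    moreover have "E t * (z t x - w t x) < 0" using lt Ep[of t] by (simp add: mult_pos_neg)
    ultimately show ?thesis by (simp add: W_def algebra_simps)
  qed
  obtain R0 where R0: "\<And>y. norm y \<ge> R0 \<Longrightarrow> \<Phi> y \<ge> (max 0 B + 1) / \<eta>" using Phi(5) by blast
  have far: "W s y \<ge> 0" if "t0 \<le> s" "s \<le> t1" "y \<in> closure \<Omega>" "norm y \<ge> R0" for s y
  proof -
    have "max 0 B + 1 \<le> \<eta> * \<Phi> y" using R0[OF that(4)] eta by (simp add: pos_divide_le_eq mult.commute)
    also have "\<dots> \<le> q s y"
      using mult_right_mono[of 1 "exp (k * (s - t0))" "\<eta> * \<Phi> y"] that k eta Phip[of y]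
      by (simp add: q_def mult_ac)
    finally have q: "max 0 B + 1 \<le> q s y" .
    have "E s \<le> 1" using that by (simp add: E_def G'_def)
    then have "E s * max 0 B \<le> max 0 B" by (simp add: mult_left_le_one_le Ep less_imp_le)
    moreover have "E s * (- max 0 B) \<le> E s * (z s y - w s y)"
      using bnd[OF that(1-3)] by (intro mult_left_mono) (auto simp: less_imp_le[OF Ep])
    ultimately show ?thesis using q by (simp add: W_def)
  qed
  define S where "S = {t0..t1} \<times> (closure \<Omega> \<inter> cball 0 R0)"
  have cS: "compact S" unfolding S_def by (intro compact_Times closed_Int_compact) auto
  have xR: "norm x < R0" using far[of t x] tx Wx by fastforce
  then have inS: "(t, x) \<in> S" using tx by (auto simp: S_def)
  have cPhi: "continuous_on UNIV \<Phi>" by (rule laplace_on_continuous[OF Phi(1)])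
  have "continuous_on S (\<lambda>(s,y). W s y)"
  proof -
    have "S \<subseteq> {0..} \<times> closure \<Omega>" using t0 by (auto simp: S_def)
    then have "continuous_on S (\<lambda>p. z (fst p) (snd p))"
      using continuous_on_subset[OF cz] by (simp add: case_prod_unfold)
    moreover have "continuous_on S (\<lambda>p. w (fst p) (snd p))"
      using continuous_on_subset[OF cw, of S] by (auto simp: case_prod_unfold)
    moreover have "continuous_on S (\<lambda>p. \<Phi> (snd p))"
      by (rule continuous_on_compose2[OF cPhi]) (auto intro: continuous_intros)
    ultimately show ?thesis unfolding W_def q_def E_def case_prod_unfold by (intro continuous_intros)
  qed
  then obtain s y where sy: "(s,y) \<in> S" and min: "\<And>s' y'. (s',y') \<in> S \<Longrightarrow> W s y \<le> W s' y'"
    using continuous_attains_inf[OF cS, of "\<lambda>(s,y). W s y"] inS by fastforce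
  have neg: "W s y < 0" using min[OF inS] Wx by linarith
  have s: "t0 \<le> s" "s \<le> t1" and y: "y \<in> closure \<Omega>" "norm y \<le> R0" using sy by (auto simp: S_def)
  have yR: "norm y < R0" using far[OF s y(1)] neg by force
  have s0: "t0 < s"
  proof (rule ccontr)
    assume "\<not> t0 < s"
    then have "s = t0" using s by simp
    then show False using init[OF y(1)] qpos[of s y] neg by (simp add: W_def E_def)
  qed
  then have sp: "s > 0" using t0 by linarith
  have zw: "z s y < w s y"
  proof (rule ccontr)
    assume "\<not> z s y < w s y"
    then have "0 \<le> E s * (z s y - w s y)" using Ep[of s] by simp
    then show False using neg qpos[of s y] by (simp add: W_def)
  qed
  define e where "e = R0 - norm y"
  have e: "e > 0" using yR by (simp add: e_def)
  have loc: "W s y \<le> W s y'" if "y' \<in> closure \<Omega>" "dist y' y < e" for y'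
  proof (rule min)
    have "norm y' < R0" using that(2) norm_triangle_ineq[of "y' - y" y] by (simp add: e_def dist_norm)
    then show "(s,y') \<in> S" using that s by (simp add: S_def)
  qed
  show False
  proof (cases "y \<in> \<Omega>")
    case True
    define N where "N = \<Omega> \<inter> ball y e"
    have N: "open N" "y \<in> N" using o e True by (auto simp: N_def)
    have qt: "((\<lambda>s. q s y) has_real_derivative k * q s y) (at s)"
      unfolding q_def by (auto intro!: derivative_eq_intros)
    have "((\<lambda>s. W s y) has_real_derivative E s * (zt s y - wt s y) - G' * E s * (z s y - w s y) + k * q s y) (at s)"
    proof -
      have "(E has_real_derivative - G' * E s) (at s)"
        unfolding E_def by (auto intro!: derivative_eq_intros)
      from DERIV_add[OF DERIV_mult[OF this DERIV_diff[OF Z(1)[OF sp True] wt]] qt]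
      show ?thesis unfolding W_def by (simp add: algebra_simps)
    qed
    then have "E s * (zt s y - wt s y) - G' * E s * (z s y - w s y) + k * q s y \<le> 0"
      by (rule left_derivative_at_min[OF _ s0]) (rule min; use sy s in \<open>auto simp: S_def\<close>)
    moreover
    have "laplace_on N (\<lambda>y. E s * (z s y + (-1) * w s y) + (\<eta> * exp (k * (s - t0))) * \<Phi> y)
      (\<lambda>y. E s *\<^sub>R (gz s y + (-1) *\<^sub>R gw s y) + (\<eta> * exp (k * (s - t0))) *\<^sub>R h y)
      (\<lambda>y. E s * (Lz s y + (-1) * Lw s y) + (\<eta> * exp (k * (s - t0))) * L y)"
      by (intro laplace_on_add laplace_on_cmult laplace_on_subset[OF Z(2)[OF sp]]
          laplace_on_subset[OF lw] laplace_on_subset[OF Phi(1)]) (auto simp: N_def)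
    then have "0 \<le> E s * (Lz s y + (-1) * Lw s y) + (\<eta> * exp (k * (s - t0))) * L y"
    proof (rule laplace_on_min[OF N(1) _ N(2)])
      fix y' assume "y' \<in> N"
      then have "W s y \<le> W s y'"
        using closure_subset by (intro loc) (auto simp: N_def dist_commute)
      then show "E s * (z s y + (-1) * w s y) + (\<eta> * exp (k * (s - t0))) * \<Phi> y
        \<le> E s * (z s y' + (-1) * w s y') + (\<eta> * exp (k * (s - t0))) * \<Phi> y'"
        by (simp add: W_def q_def)
    qed
    moreover have "(\<eta> * exp (k * (s - t0))) * L y \<le> K * q s y"
      using mult_left_mono[OF Phi(4)[of y], of "\<eta> * exp (k * (s - t0))"] eta
      by (simp add: q_def mult_ac)
    ultimately have "0 \<le> E s * (Lz s y - Lw s y) + K * q s y"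
      and 1: "E s * (zt s y - wt s y) - G' * E s * (z s y - w s y) + k * q s y \<le> 0"
      by auto
    then have "d * 0 \<le> d * (E s * (Lz s y - Lw s y) + K * q s y)" using d by (intro mult_left_mono) auto
    then have 2: "0 \<le> E s * (d * Lz s y - d * Lw s y) + d * K * q s y" by (simp add: algebra_simps)
    have "G' * (z s y - w s y) \<le> G * (z s y - w s y)"
      using zw by (intro mult_right_mono_neg) (auto simp: G'_def)
    also have "\<dots> \<le> f s y - (wt s y - d * Lw s y)" by (rule sub[OF s0 s(2) True zw])
    finally have "E s * (G' * (z s y - w s y)) \<le> E s * (f s y - (wt s y - d * Lw s y))"
      using Ep[of s] by simp
    then have "q s y \<le> 0"
      using 1 2 unfolding Z(3)[OF sp True] k_def by (simp add: algebra_simps)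
    then show False using qpos[of s y] by linarith
  next
    case False
    then have yf: "y \<in> frontier \<Omega>" using y(1) o by (simp add: frontier_def interior_open)
    obtain r \<rho> g where g: "local_C2_defining \<Omega> y r \<rho> g" "gw s y \<bullet> g y \<le> 0"
      using bdry[OF s0 s(2) yf zw] by blast
    obtain D where D: "(z s has_derivative D) (at y within closure \<Omega>)" "D (g y) = 0"
      using z sp yf g(1) unfolding classical_neumann_eq_def by blast
    have dw: "(w s has_derivative (\<lambda>h. gw s y \<bullet> h)) (at y within closure \<Omega>)"
      and dP: "(\<Phi> has_derivative (\<lambda>v. h y \<bullet> v)) (at y within closure \<Omega>)"
      using lw Phi(1) has_derivative_at_withinI unfolding laplace_on_def by blast+
    have "(W s has_derivative (\<lambda>v. E s * (D v - gw s y \<bullet> v) + \<eta> * exp (k * (s - t0)) * (h y \<bullet> v))) (at y within closure \<Omega>)"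
      unfolding W_def q_def
      by (intro has_derivative_add has_derivative_diff D dw has_derivative_mult_right dP)
    then have "E s * (D (g y) - gw s y \<bullet> g y) + \<eta> * exp (k * (s - t0)) * (h y \<bullet> g y) \<le> 0"
      by (rule inward_derivative_at_min[where F = "W s", OF o yf g(1) _ e]) (rule loc)
    moreover have "\<eta> * exp (k * (s - t0)) * (h y \<bullet> g y) > 0"
      using Phi(6)[OF yf g(1)] eta by simp
    moreover have "E s * (D (g y) - gw s y \<bullet> g y) \<ge> 0"
      using D(2) g(2) Ep[of s] by (simp add: mult_nonneg_nonpos)
    ultimately show False by linarith
  qed
qed

lemma neumann_lower_bound:
  fixes \<Omega> :: "'a::euclidean_space set"
  assumes ext: "exterior_domain \<Omega>" and C2: "C2_domain \<Omega>" and d: "d > 0"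
    and z: "classical_neumann_eq \<Omega> d f z"
    and cz: "continuous_on ({0..} \<times> closure \<Omega>) (\<lambda>(t,x). z t x)"
    and bnd: "\<And>t x. 0 \<le> t \<Longrightarrow> x \<in> closure \<Omega> \<Longrightarrow> \<bar>z t x\<bar> \<le> B"
    and init: "\<And>x. x \<in> closure \<Omega> \<Longrightarrow> m \<le> z 0 x"
    and sub: "\<And>t x. 0 < t \<Longrightarrow> x \<in> \<Omega> \<Longrightarrow> z t x < m \<Longrightarrow> f t x \<ge> G * (z t x - m)"
    and tx: "0 \<le> t" "x \<in> closure \<Omega>"
  shows "m \<le> z t x"
proof (rule neumann_comparison[OF ext C2 d z cz order.refl, where w = "\<lambda>t x. m" and wt = "\<lambda>t x. 0"
      and gw = "\<lambda>t x. 0" and Lw = "\<lambda>t x. 0" and B = "B + m" and G = G and ?t1.0 = t])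
  show "- (B + m) \<le> z s y - m" if "0 \<le> s" "s \<le> t" "y \<in> closure \<Omega>" for s y
    using bnd[of s y] that by auto
  show "\<exists>r \<rho> g. local_C2_defining \<Omega> p r \<rho> g \<and> (0::'a) \<bullet> g p \<le> 0" if "p \<in> frontier \<Omega>" for p
    using C2 that unfolding C2_domain_def by auto
qed (use init sub tx in \<open>auto simp: laplace_on_const case_prod_unfold\<close>)

section \<open>Travelling and expanding bumps\<close>

definition bump :: "real \<Rightarrow> real \<Rightarrow> real \<Rightarrow> real \<Rightarrow> 'a::euclidean_space \<Rightarrow> 'a \<Rightarrow> real \<Rightarrow> real \<Rightarrow> real \<Rightarrow> 'a \<Rightarrow> real" where
  "bump d \<epsilon> K \<beta> k q \<sigma> t0 t x =
     \<epsilon> * exp (K * (t - t0) - (k \<bullet> (x - (q + (t - t0) *\<^sub>R k))) / (2 * d))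
       * (max 0 (\<sigma> + \<beta> * (t - t0) - (norm (x - (q + (t - t0) *\<^sub>R k)))\<^sup>2))^3"

lemma bump_continuous: "continuous_on UNIV (\<lambda>(t,x). bump d \<epsilon> K \<beta> k q \<sigma> t0 t x)"
  unfolding bump_def case_prod_unfold divide_inverse by (intro continuous_intros)

lemma bump_nonneg: "\<epsilon> \<ge> 0 \<Longrightarrow> bump d \<epsilon> K \<beta> k q \<sigma> t0 t x \<ge> 0"
  unfolding bump_def by simp

text \<open>The exponential weight \<open>exp (- k \<bullet> y / (2 * d))\<close> removes the first-order term that the
  drift \<open>k\<close> produces; the remaining inequality is a quadratic one in \<open>\<sigma> - |y|^2\<close>.\<close>
lemma bump_subsolution:
  fixes k q :: "'a::euclidean_space" and d \<epsilon> K \<beta> \<sigma> t0 \<mu> :: real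
  assumes d: "d > 0" and \<epsilon>: "\<epsilon> \<ge> 0" and \<beta>: "\<beta> \<ge> 0"
    and P: "P > 0" "P \<le> \<mu> - K - (norm k)\<^sup>2 / (4 * d)"
    and quad: "(3 * \<beta> + 6 * d * real DIM('a) + 24 * d)\<^sup>2 \<le> 96 * d * P * \<sigma>"
  obtains wt gw Lw where
    "\<And>t x. ((\<lambda>s. bump d \<epsilon> K \<beta> k q \<sigma> t0 s x) has_real_derivative wt t x) (at t)"
    "\<And>t. laplace_on UNIV (bump d \<epsilon> K \<beta> k q \<sigma> t0 t) (gw t) (Lw t)"
    "\<And>t x. t0 \<le> t \<Longrightarrow> wt t x - d * Lw t x \<le> \<mu> * bump d \<epsilon> K \<beta> k q \<sigma> t0 t x"
    "\<And>t x. k = 0 \<Longrightarrow> \<exists>c\<ge>0. gw t x = (- c) *\<^sub>R (x - q)"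
proof -
  define y where "y = (\<lambda>t x. x - (q + (t - t0) *\<^sub>R k))"
  define E where "E = (\<lambda>t x. \<epsilon> * exp (K * (t - t0) - (k \<bullet> y t x) / (2 * d)))"
  define S where "S = (\<lambda>t x. \<sigma> + \<beta> * (t - t0) - (norm (y t x))\<^sup>2)"
  define s where "s = (\<lambda>t x. max 0 (S t x))"
  define N where "N = real DIM('a)"
  have w: "bump d \<epsilon> K \<beta> k q \<sigma> t0 = (\<lambda>t x. E t x * (s t x)^3)"
    by (auto simp: fun_eq_iff bump_def E_def s_def S_def y_def)
  define wt where "wt = (\<lambda>t x. E t x * ((K + (norm k)\<^sup>2 / (2 * d)) * (s t x)^3
      + 3 * (s t x)\<^sup>2 * (\<beta> + 2 * (k \<bullet> y t x))))"
  define gw where "gw = (\<lambda>t x. E t x *\<^sub>R ((3 * (s t x)\<^sup>2) *\<^sub>R (0 + (-1) *\<^sub>R (2 *\<^sub>R y t x)))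
      + (s t x)^3 *\<^sub>R ((- E t x) *\<^sub>R ((1 / (2 * d)) *\<^sub>R k)))"
  define Lw where "Lw = (\<lambda>t x. E t x * (6 * s t x * (norm (0 + (-1) *\<^sub>R (2 *\<^sub>R y t x)))\<^sup>2
        + 3 * (s t x)\<^sup>2 * (0 + (-1) * (2 * N)))
      + (s t x)^3 * (E t x * (norm ((1 / (2 * d)) *\<^sub>R k))\<^sup>2 + (- E t x) * 0)
      + 2 * (((- E t x) *\<^sub>R ((1 / (2 * d)) *\<^sub>R k)) \<bullet> ((3 * (s t x)\<^sup>2) *\<^sub>R (0 + (-1) *\<^sub>R (2 *\<^sub>R y t x)))))"
  have time: "((\<lambda>s. bump d \<epsilon> K \<beta> k q \<sigma> t0 s x) has_real_derivative wt t x) (at t)" for t x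
  proof -
    have ky: "k \<bullet> y t x = k \<bullet> (x - q) - (t - t0) * (norm k)\<^sup>2" for t
      by (simp add: y_def inner_diff_right inner_add_right power2_norm_eq_inner algebra_simps)
    have yy: "(norm (y t x))\<^sup>2 = (norm (x - q))\<^sup>2 - 2 * (t - t0) * (k \<bullet> (x - q)) + (t - t0)\<^sup>2 * (norm k)\<^sup>2" for t
    proof -
      have eq: "y t x = (x - q) - (t - t0) *\<^sub>R k" by (simp add: y_def)
      show ?thesis unfolding power2_norm_eq_inner eq
        by (simp add: inner_diff_left inner_diff_right inner_commute power2_eq_square algebra_simps)
    qed
    have "((\<lambda>t. E t x) has_real_derivative E t x * (K + (norm k)\<^sup>2 / (2 * d))) (at t)"
      unfolding E_def ky using d by (auto intro!: derivative_eq_intros simp: field_simps)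
    moreover have "((\<lambda>t. S t x) has_real_derivative \<beta> + 2 * (k \<bullet> y t x)) (at t)"
      unfolding S_def yy ky by (auto intro!: derivative_eq_intros simp: algebra_simps)
    then have "((\<lambda>t. (s t x)^3) has_real_derivative 3 * (s t x)\<^sup>2 * (\<beta> + 2 * (k \<bullet> y t x))) (at t)"
      using DERIV_chain2[where f = "\<lambda>r. (max 0 r)^3" and g = "\<lambda>t. S t x" and x = t,
          OF has_real_derivative_max0_power[of 3 "S t x", simplified]]
      by (simp add: s_def)
    ultimately have "((\<lambda>t. E t x * (s t x)^3) has_real_derivative
       E t x * (K + (norm k)\<^sup>2 / (2 * d)) * (s t x)^3
        + 3 * (s t x)\<^sup>2 * (\<beta> + 2 * (k \<bullet> y t x)) * E t x) (at t)"
      by (rule DERIV_mult)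
    then show ?thesis unfolding w wt_def by (simp add: algebra_simps)
  qed
  have space: "laplace_on UNIV (bump d \<epsilon> K \<beta> k q \<sigma> t0 t) (gw t) (Lw t)" for t
  proof -
    define A where "A = K * (t - t0) + (k \<bullet> (q + (t - t0) *\<^sub>R k)) / (2 * d)"
    define b where "b = (1 / (2 * d)) *\<^sub>R k"
    have E: "E t x = \<epsilon> * exp (A - b \<bullet> x)" for x
      using d by (simp add: E_def A_def b_def y_def inner_diff_right diff_divide_distrib)
    have "laplace_on UNIV (\<lambda>x. \<epsilon> * exp (A - b \<bullet> x)) (\<lambda>x. (- (\<epsilon> * exp (A - b \<bullet> x))) *\<^sub>R b)
       (\<lambda>x. \<epsilon> * exp (A - b \<bullet> x) * (norm b)\<^sup>2 + (- (\<epsilon> * exp (A - b \<bullet> x))) * 0)"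
      by (rule laplace_on_compose[OF laplace_on_inner, of "\<lambda>r. \<epsilon> * exp (A - r)"])
        (auto intro!: derivative_eq_intros)
    then have 1: "laplace_on UNIV (E t) (\<lambda>x. (- E t x) *\<^sub>R b) (\<lambda>x. E t x * (norm b)\<^sup>2 + (- E t x) * 0)"
      unfolding E by (simp add: E[abs_def])
    have "laplace_on UNIV (\<lambda>x. (\<sigma> + \<beta> * (t - t0)) + (-1) * (norm (x - (q + (t - t0) *\<^sub>R k)))\<^sup>2)
       (\<lambda>x. 0 + (-1) *\<^sub>R (2 *\<^sub>R (x - (q + (t - t0) *\<^sub>R k)))) (\<lambda>x. 0 + (-1) * (2 * real DIM('a)))"
      by (intro laplace_on_add laplace_on_const laplace_on_cmult laplace_on_norm2)
    then have "laplace_on UNIV (S t) (\<lambda>x. 0 + (-1) *\<^sub>R (2 *\<^sub>R y t x)) (\<lambda>x. 0 + (-1) * (2 * N))"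
      by (simp add: S_def[abs_def] y_def N_def)
    from laplace_on_mult[OF 1 laplace_on_max0_cube[OF this]]
    show ?thesis unfolding w gw_def Lw_def s_def b_def .
  qed
  have ineq: "wt t x - d * Lw t x \<le> \<mu> * bump d \<epsilon> K \<beta> k q \<sigma> t0 t x" if t: "t0 \<le> t" for t x
  proof (cases "S t x > 0")
    case False
    then have "s t x = 0" by (simp add: s_def)
    then show ?thesis by (simp add: w wt_def Lw_def)
  next
    case True
    define \<tau> where "\<tau> = s t x"
    have \<tau>: "\<tau> > 0" "(norm (y t x))\<^sup>2 = \<sigma> + \<beta> * (t - t0) - \<tau>"
      using True by (auto simp: \<tau>_def s_def S_def)
    define e where "e = E t x"
    have e: "e \<ge> 0" using \<epsilon> by (simp add: e_def E_def)
    define \<kappa> where "\<kappa> = (norm k)\<^sup>2 / (4 * d)"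
    define a where "a = 3 * \<beta> + 6 * d * N + 24 * d"
    have L: "Lw t x = e * (24 * \<tau> * (\<sigma> + \<beta> * (t - t0) - \<tau>) - 6 * N * \<tau>\<^sup>2 + \<tau>^3 * (\<kappa> / d)
        + 6 * \<tau>\<^sup>2 * (k \<bullet> y t x) / d)"
      unfolding Lw_def \<tau>(2)[symmetric] e_def[symmetric] \<tau>_def[symmetric] \<kappa>_def using d
      by (simp add: power_mult_distrib power_divide field_simps power2_eq_square)
    have "wt t x - d * Lw t x = e * \<tau> * ((K + \<kappa>) * \<tau>\<^sup>2 + a * \<tau> - 24 * d * (\<sigma> + \<beta> * (t - t0)))"
      unfolding L wt_def e_def[symmetric] \<tau>_def[symmetric] \<kappa>_def a_def using d
      by (simp add: field_simps power2_eq_square power3_eq_cube)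
    also have "\<dots> \<le> e * \<tau> * (\<mu> * \<tau>\<^sup>2)"
    proof (rule mult_left_mono)
      have "0 \<le> 4 * P * (P * \<tau>\<^sup>2 - a * \<tau> + 24 * d * \<sigma>)"
      proof -
        have "4 * P * (P * \<tau>\<^sup>2 - a * \<tau> + 24 * d * \<sigma>) = (2 * P * \<tau> - a)\<^sup>2 + (96 * d * P * \<sigma> - a\<^sup>2)"
          by (simp add: power2_eq_square algebra_simps)
        then show ?thesis using quad by (simp add: a_def N_def)
      qed
      then have "0 \<le> P * \<tau>\<^sup>2 - a * \<tau> + 24 * d * \<sigma>" using P(1) by (simp add: zero_le_mult_iff)
      moreover have "P * \<tau>\<^sup>2 \<le> (\<mu> - K - \<kappa>) * \<tau>\<^sup>2"
        using P(2) by (intro mult_right_mono) (auto simp: \<kappa>_def)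
      moreover have "0 \<le> 24 * d * (\<beta> * (t - t0))" using d \<beta> t by simp
      ultimately show "(K + \<kappa>) * \<tau>\<^sup>2 + a * \<tau> - 24 * d * (\<sigma> + \<beta> * (t - t0)) \<le> \<mu> * \<tau>\<^sup>2"
        by (simp add: algebra_simps)
      show "0 \<le> e * \<tau>" using e \<tau> by simp
    qed
    also have "\<dots> = \<mu> * bump d \<epsilon> K \<beta> k q \<sigma> t0 t x"
      by (simp add: w e_def \<tau>_def power2_eq_square power3_eq_cube)
    finally show ?thesis .
  qed
  have grad: "\<exists>c\<ge>0. gw t x = (- c) *\<^sub>R (x - q)" if "k = 0" for t x
  proof (intro exI conjI)
    show "0 \<le> 6 * E t x * (s t x)\<^sup>2" using \<epsilon> by (simp add: E_def)
    show "gw t x = (- (6 * E t x * (s t x)\<^sup>2)) *\<^sub>R (x - q)"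
      using that by (simp add: gw_def y_def)
  qed
  show thesis by (rule that[OF time space ineq grad])
qed

section \<open>Bounds and positivity\<close>

locale competition_system =
  fixes \<Omega> :: "'a::euclidean_space set"
    and d1 d2 r1 r2 a1 a2 :: real
    and u0 v0 :: "'a \<Rightarrow> real"
    and u v :: "real \<Rightarrow> 'a \<Rightarrow> real"
  assumes ext: "exterior_domain \<Omega>" and C2: "C2_domain \<Omega>"
    and pos: "d1 > 0" "d2 > 0" "r1 > 0" "r2 > 0" "0 < a1" "a1 < 1" "1 < a2"
    and Theta: "in_Theta \<Omega> u0 v0"
    and sol: "LV_solution \<Omega> d1 d2 r1 r2 a1 a2 u0 v0 u v"
begin

lemma open_domain: "open \<Omega>"
  using ext by (simp add: exterior_domain_def)

lemma in_closure: "x \<in> \<Omega> \<Longrightarrow> x \<in> closure \<Omega>"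
  using closure_subset by blast

lemma cont_u: "continuous_on ({0..} \<times> closure \<Omega>) (\<lambda>(t,x). u t x)"
  and cont_v: "continuous_on ({0..} \<times> closure \<Omega>) (\<lambda>(t,x). v t x)"
  and eq_u: "classical_neumann_eq \<Omega> d1 (\<lambda>t x. r1 * u t x * (1 - u t x - a1 * v t x)) u"
  and eq_v: "classical_neumann_eq \<Omega> d2 (\<lambda>t x. r2 * v t x * (1 - v t x - a2 * u t x)) v"
  using sol unfolding LV_solution_def by auto

lemma cont_minus_u: "continuous_on ({0..} \<times> closure \<Omega>) (\<lambda>(t,x). - u t x)"
  and cont_minus_v: "continuous_on ({0..} \<times> closure \<Omega>) (\<lambda>(t,x). - v t x)"
  using continuous_on_minus[OF cont_u] continuous_on_minus[OF cont_v] by (auto simp: case_prod_unfold)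

lemma initial_bounds:
  assumes "x \<in> closure \<Omega>"
  shows "0 \<le> u 0 x" "u 0 x \<le> 1" "0 \<le> v 0 x" "v 0 x \<le> 1"
  using assms sol Theta unfolding LV_solution_def in_Theta_def by auto

lemma bounded_solution:
  obtains B where "B \<ge> 0" "\<And>t x. 0 \<le> t \<Longrightarrow> x \<in> closure \<Omega> \<Longrightarrow> \<bar>u t x\<bar> \<le> B"
    "\<And>t x. 0 \<le> t \<Longrightarrow> x \<in> closure \<Omega> \<Longrightarrow> \<bar>v t x\<bar> \<le> B"
proof -
  obtain B1 B2 where B: "\<forall>p\<in>{0..} \<times> closure \<Omega>. norm ((\<lambda>(t,x). u t x) p) \<le> B1"
      "\<forall>p\<in>{0..} \<times> closure \<Omega>. norm ((\<lambda>(t,x). v t x) p) \<le> B2"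
    using sol unfolding LV_solution_def bounded_iff ball_simps by blast
  show thesis
  proof (rule that[of "max 0 (max B1 B2)"])
    fix t x assume "(0::real) \<le> t" "x \<in> closure \<Omega>"
    then show "\<bar>u t x\<bar> \<le> max 0 (max B1 B2)" "\<bar>v t x\<bar> \<le> max 0 (max B1 B2)"
      using bspec[OF B(1), of "(t,x)"] bspec[OF B(2), of "(t,x)"] by auto
  qed simp
qed

lemma u_nonneg:
  assumes "0 \<le> t" "x \<in> closure \<Omega>"
  shows "0 \<le> u t x"
proof -
  obtain B where B: "B \<ge> 0" "\<And>t x. 0 \<le> t \<Longrightarrow> x \<in> closure \<Omega> \<Longrightarrow> \<bar>u t x\<bar> \<le> B"
    "\<And>t x. 0 \<le> t \<Longrightarrow> x \<in> closure \<Omega> \<Longrightarrow> \<bar>v t x\<bar> \<le> B" by (rule bounded_solution) (rule that; blast)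
  show ?thesis
  proof (rule neumann_lower_bound[OF ext C2 pos(1) eq_u cont_u B(2), where G = "r1 * (1 + B + a1 * B)"])
    fix t x assume tx: "0 < t" "x \<in> \<Omega>" "u t x < 0"
    then have x: "x \<in> closure \<Omega>" by (simp add: in_closure)
    have "a1 * (- v t x) \<le> a1 * B" using B(3)[of t x] tx x pos by (intro mult_left_mono) auto
    then have "1 - u t x - a1 * v t x \<le> 1 + B + a1 * B" using B(2)[of t x] tx x by auto
    then have "r1 * (1 - u t x - a1 * v t x) \<le> r1 * (1 + B + a1 * B)" using pos by simp
    from mult_right_mono_neg[OF this, of "u t x"]
    show "r1 * (1 + B + a1 * B) * (u t x - 0) \<le> r1 * u t x * (1 - u t x - a1 * v t x)"
      using tx by (simp add: mult_ac)
  qed (use assms initial_bounds in auto)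
qed

lemma v_nonneg:
  assumes "0 \<le> t" "x \<in> closure \<Omega>"
  shows "0 \<le> v t x"
proof -
  obtain B where B: "B \<ge> 0" "\<And>t x. 0 \<le> t \<Longrightarrow> x \<in> closure \<Omega> \<Longrightarrow> \<bar>u t x\<bar> \<le> B"
    "\<And>t x. 0 \<le> t \<Longrightarrow> x \<in> closure \<Omega> \<Longrightarrow> \<bar>v t x\<bar> \<le> B" by (rule bounded_solution) (rule that; blast)
  show ?thesis
  proof (rule neumann_lower_bound[OF ext C2 pos(2) eq_v cont_v B(3), where G = "r2 * (1 + B)"])
    fix t x assume tx: "0 < t" "x \<in> \<Omega>" "v t x < 0"
    then have x: "x \<in> closure \<Omega>" by (simp add: in_closure)
    have "a2 * u t x \<ge> 0" using u_nonneg[of t x] tx x pos by simp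
    then have "1 - v t x - a2 * u t x \<le> 1 + B" using B(3)[of t x] tx x by auto
    then have "r2 * (1 - v t x - a2 * u t x) \<le> r2 * (1 + B)" using pos by simp
    from mult_right_mono_neg[OF this, of "v t x"]
    show "r2 * (1 + B) * (v t x - 0) \<le> r2 * v t x * (1 - v t x - a2 * u t x)"
      using tx by (simp add: mult_ac)
  qed (use assms initial_bounds in auto)
qed

lemma u_le_1:
  assumes "0 \<le> t" "x \<in> closure \<Omega>"
  shows "u t x \<le> 1"
proof -
  obtain B where B: "B \<ge> 0" "\<And>t x. 0 \<le> t \<Longrightarrow> x \<in> closure \<Omega> \<Longrightarrow> \<bar>u t x\<bar> \<le> B"
    "\<And>t x. 0 \<le> t \<Longrightarrow> x \<in> closure \<Omega> \<Longrightarrow> \<bar>v t x\<bar> \<le> B" by (rule bounded_solution) (rule that; blast)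
  have "-1 \<le> - u t x"
  proof (rule neumann_lower_bound[OF ext C2 pos(1) classical_neumann_eq_uminus[OF eq_u] cont_minus_u, where B = B and G = 0])
    fix t x assume tx: "0 < t" "x \<in> \<Omega>" "- u t x < -1"
    then have "a1 * v t x \<ge> 0" using v_nonneg[OF _ in_closure[of x], of t] pos by auto
    then have "1 - u t x - a1 * v t x \<le> 0" using tx by simp
    then have "r1 * u t x * (1 - u t x - a1 * v t x) \<le> 0"
      using tx pos by (intro mult_nonneg_nonpos) auto
    then show "0 * (- u t x - -1) \<le> - (r1 * u t x * (1 - u t x - a1 * v t x))" by simp
  qed (use assms initial_bounds B in auto)
  then show ?thesis by simp
qed

lemma v_le_1:
  assumes "0 \<le> t" "x \<in> closure \<Omega>"
  shows "v t x \<le> 1"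
proof -
  obtain B where B: "B \<ge> 0" "\<And>t x. 0 \<le> t \<Longrightarrow> x \<in> closure \<Omega> \<Longrightarrow> \<bar>u t x\<bar> \<le> B"
    "\<And>t x. 0 \<le> t \<Longrightarrow> x \<in> closure \<Omega> \<Longrightarrow> \<bar>v t x\<bar> \<le> B" by (rule bounded_solution) (rule that; blast)
  have "-1 \<le> - v t x"
  proof (rule neumann_lower_bound[OF ext C2 pos(2) classical_neumann_eq_uminus[OF eq_v] cont_minus_v, where B = B and G = 0])
    fix t x assume tx: "0 < t" "x \<in> \<Omega>" "- v t x < -1"
    then have "a2 * u t x \<ge> 0" using u_nonneg[OF _ in_closure[of x], of t] pos by auto
    then have "1 - v t x - a2 * u t x \<le> 0" using tx by simp
    then have "r2 * v t x * (1 - v t x - a2 * u t x) \<le> 0"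
      using tx pos by (intro mult_nonneg_nonpos) auto
    then show "0 * (- v t x - -1) \<le> - (r2 * v t x * (1 - v t x - a2 * u t x))" by simp
  qed (use assms initial_bounds B in auto)
  then show ?thesis by simp
qed

lemma positivity_expanding_ball:
  assumes t: "0 \<le> t0" "t0 < t1" and r: "0 < r0" "r0 < r" and m: "m > 0"
    and init: "\<And>x. x \<in> closure \<Omega> \<Longrightarrow> norm (x - q) \<le> r0 \<Longrightarrow> m \<le> u t0 x"
    and bdry: "\<And>p. p \<in> frontier \<Omega> \<Longrightarrow> norm (p - q) < r \<Longrightarrow>
       \<exists>r \<rho> g. local_C2_defining \<Omega> p r \<rho> g \<and> (p - q) \<bullet> g p \<ge> 0"
    and x: "x \<in> closure \<Omega>" "norm (x - q) < r"
  shows "0 < u t1 x"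
proof -
  define \<beta> where "\<beta> = (r\<^sup>2 - r0\<^sup>2) / (t1 - t0)"
  have rr: "r0\<^sup>2 < r\<^sup>2" using r by (intro power_strict_mono) auto
  have \<beta>: "\<beta> \<ge> 0" using rr t by (simp add: \<beta>_def)
  have \<beta>1: "\<beta> * (s - t0) \<le> r\<^sup>2 - r0\<^sup>2" if "s \<le> t1" for s
  proof -
    have "\<beta> * (s - t0) \<le> \<beta> * (t1 - t0)" using that \<beta> by (intro mult_left_mono) auto
    then show ?thesis using t by (simp add: \<beta>_def)
  qed
  define a where "a = 3 * \<beta> + 6 * d1 * real DIM('a) + 24 * d1"
  have r02: "r0\<^sup>2 > 0" using r by simp
  define P where "P = a\<^sup>2 / (96 * d1 * r0\<^sup>2) + 1"
  have P: "P > 0" using pos r02 by (simp add: P_def add_nonneg_pos)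
  have quad: "a\<^sup>2 \<le> 96 * d1 * P * r0\<^sup>2"
    using pos r02 by (simp add: P_def field_simps)
  define K where "K = - (r1 * a1) - P"
  define \<epsilon> where "\<epsilon> = m / (r0\<^sup>2)^3"
  have \<epsilon>: "\<epsilon> > 0" using m r02 by (simp add: \<epsilon>_def)
  define w where "w = bump d1 \<epsilon> K \<beta> 0 q (r0\<^sup>2) t0"
  have weq: "w s y = \<epsilon> * exp (K * (s - t0)) * (max 0 (r0\<^sup>2 + \<beta> * (s - t0) - (norm (y - q))\<^sup>2))^3" for s y
    by (simp add: w_def bump_def)
  obtain wt gw Lw where W:
    "\<And>t x. ((\<lambda>s. w s x) has_real_derivative wt t x) (at t)"
    "\<And>t. laplace_on UNIV (w t) (gw t) (Lw t)"
    "\<And>t x. t0 \<le> t \<Longrightarrow> wt t x - d1 * Lw t x \<le> - (r1 * a1) * w t x"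
    "\<And>t x. \<exists>c\<ge>0. gw t x = (- c) *\<^sub>R (x - q)"
  proof (rule bump_subsolution[where d = d1 and \<epsilon> = \<epsilon> and K = K and \<beta> = \<beta> and k = "0::'a"
        and \<sigma> = "r0\<^sup>2" and P = P and \<mu> = "- (r1 * a1)" and q = q and ?t0.0 = t0])
    show "P \<le> - (r1 * a1) - K - (norm (0::'a))\<^sup>2 / (4 * d1)" by (simp add: K_def)
    show "(3 * \<beta> + 6 * d1 * real DIM('a) + 24 * d1)\<^sup>2 \<le> 96 * d1 * P * r0\<^sup>2" using quad by (simp add: a_def)
  qed (use that pos \<epsilon> \<beta> P in \<open>auto simp: w_def\<close>)
  have wpos: "r0\<^sup>2 + \<beta> * (s - t0) - (norm (y - q))\<^sup>2 > 0" if "w s y > 0" for s y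
    using that by (rule_tac ccontr) (simp add: weq)
  have "w t1 x \<le> u t1 x"
  proof (rule neumann_comparison[OF ext C2 pos(1) eq_u cont_u t(1) _ W(1,2), where B = "\<epsilon> * (r\<^sup>2)^3" and G = 0 and ?t1.0 = t1])
    show "continuous_on UNIV (\<lambda>(t, x). w t x)" unfolding w_def by (rule bump_continuous)
    fix s y assume s: "t0 \<le> s" "s \<le> t1" and y: "y \<in> closure \<Omega>"
    have "r1 * a1 > 0" using pos by simp
    then have "K * (s - t0) \<le> 0" using s P by (intro mult_nonpos_nonneg) (auto simp: K_def)
    then have 1: "exp (K * (s - t0)) \<le> 1" by simp
    have "max 0 (r0\<^sup>2 + \<beta> * (s - t0) - (norm (y - q))\<^sup>2) \<le> r\<^sup>2"
      using \<beta>1[OF s(2)] zero_le_power2[of "norm (y - q)"] zero_le_power2[of r]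
      by (intro max.boundedI; linarith)
    then have "(max 0 (r0\<^sup>2 + \<beta> * (s - t0) - (norm (y - q))\<^sup>2))^3 \<le> (r\<^sup>2)^3" by (intro power_mono) auto
    then have "exp (K * (s - t0)) * (max 0 (r0\<^sup>2 + \<beta> * (s - t0) - (norm (y - q))\<^sup>2))^3 \<le> 1 * (r\<^sup>2)^3"
      using 1 by (intro mult_mono) auto
    then have "w s y \<le> \<epsilon> * (r\<^sup>2)^3" using \<epsilon> by (simp add: weq mult.assoc)
    then show "- (\<epsilon> * (r\<^sup>2)^3) \<le> u s y - w s y" using u_nonneg[of s y] s t y by auto
  next
    fix y assume y: "y \<in> closure \<Omega>"
    show "w t0 y \<le> u t0 y"
    proof (cases "norm (y - q) \<le> r0")
      case True
      have "(max 0 (r0\<^sup>2 - (norm (y - q))\<^sup>2))^3 \<le> (r0\<^sup>2)^3" by (intro power_mono) auto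
      then have "w t0 y \<le> \<epsilon> * (r0\<^sup>2)^3" using \<epsilon> by (simp add: weq)
      also have "\<dots> = m" using r by (simp add: \<epsilon>_def)
      finally show ?thesis using init[OF y True] by simp
    next
      case False
      then have "r0\<^sup>2 \<le> (norm (y - q))\<^sup>2" using r by (intro power_mono) auto
      then show ?thesis using u_nonneg[of t0 y] t y by (simp add: weq)
    qed
  next
    fix s y assume s: "t0 < s" "s \<le> t1" and y: "y \<in> \<Omega>" and lt: "u s y < w s y"
    have y': "y \<in> closure \<Omega>" by (rule in_closure[OF y])
    have s0: "0 \<le> s" using s t by simp
    have "a1 * v s y \<le> a1" using v_le_1[OF s0 y'] pos by simp
    then have "1 - u s y - a1 * v s y \<ge> - a1" using u_le_1[OF s0 y'] by linarith
    then have "r1 * u s y * (1 - u s y - a1 * v s y) \<ge> r1 * u s y * (- a1)"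
      using pos u_nonneg[OF s0 y'] by (intro mult_left_mono) auto
    moreover have "r1 * a1 * u s y \<le> r1 * a1 * w s y" using lt pos by (intro mult_left_mono) auto
    moreover have "wt s y - d1 * Lw s y \<le> - (r1 * a1) * w s y" using W(3) s by simp
    ultimately show "0 * (u s y - w s y) \<le> r1 * u s y * (1 - u s y - a1 * v s y) - (wt s y - d1 * Lw s y)"
      by (simp add: algebra_simps)
  next
    fix s p assume s: "t0 < s" "s \<le> t1" and p: "p \<in> frontier \<Omega>" and lt: "u s p < w s p"
    have "p \<in> closure \<Omega>" using p by (simp add: frontier_def)
    then have "w s p > 0" using lt u_nonneg[of s p] s t by auto
    then have "(norm (p - q))\<^sup>2 < r\<^sup>2" using wpos[of s p] \<beta>1[OF s(2)] by simp
    then have "norm (p - q) < r" using r by (intro power2_less_imp_less[of "norm (p - q)" r]) auto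
    then obtain rr \<rho> g where g: "local_C2_defining \<Omega> p rr \<rho> g" "(p - q) \<bullet> g p \<ge> 0" using bdry[OF p] by blast
    obtain c where "c \<ge> 0" "gw s p = (- c) *\<^sub>R (p - q)" using W(4) by blast
    then have "gw s p \<bullet> g p \<le> 0" using g(2) by simp
    then show "\<exists>r \<rho> g. local_C2_defining \<Omega> p r \<rho> g \<and> gw s p \<bullet> g p \<le> 0" using g(1) by blast
  qed (use t x in auto)
  moreover have "w t1 x > 0"
  proof -
    have "(norm (x - q))\<^sup>2 < r\<^sup>2" using x(2) by (intro power_strict_mono) auto
    moreover have "\<beta> * (t1 - t0) = r\<^sup>2 - r0\<^sup>2" using t by (simp add: \<beta>_def)
    ultimately show ?thesis using \<epsilon> by (simp add: weq)
  qed
  ultimately show ?thesis by linarith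
qed

lemma cont_u_at:
  assumes "0 \<le> t"
  shows "continuous_on (closure \<Omega>) (u t)"
proof -
  have "continuous_on (closure \<Omega>) (\<lambda>x. (\<lambda>(t,x). u t x) (t, x))"
    by (rule continuous_on_compose2[OF cont_u]) (use assms in \<open>auto intro!: continuous_intros\<close>)
  then show ?thesis by simp
qed

lemma positive_nearby:
  assumes "0 \<le> t" "q \<in> closure \<Omega>" "0 < u t q"
  obtains r where "r > 0" "\<And>x. x \<in> closure \<Omega> \<Longrightarrow> norm (x - q) < r \<Longrightarrow> u t q / 2 \<le> u t x"
proof -
  have "u t q / 2 > 0" using assms by simp
  then obtain r where r: "r > 0" "\<And>x. x \<in> closure \<Omega> \<Longrightarrow> dist x q < r \<Longrightarrow> dist (u t x) (u t q) < u t q / 2"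
    using cont_u_at[OF assms(1)] assms(2) unfolding continuous_on_iff by metis
  show thesis
  proof (rule that[OF r(1)])
    fix x assume "x \<in> closure \<Omega>" "norm (x - q) < r"
    then have "\<bar>u t x - u t q\<bar> < u t q / 2" using r(2)[of x] by (simp add: dist_norm)
    then show "u t q / 2 \<le> u t x" by linarith
  qed
qed

lemma positivity_spreads:
  assumes t: "0 \<le> t0" "t0 < t1" and q: "q \<in> closure \<Omega>" "0 < u t0 q"
    and bdry: "\<And>p. p \<in> frontier \<Omega> \<Longrightarrow> norm (p - q) < r \<Longrightarrow>
       \<exists>r \<rho> g. local_C2_defining \<Omega> p r \<rho> g \<and> (p - q) \<bullet> g p \<ge> 0"
    and x: "x \<in> closure \<Omega>" "norm (x - q) < r"
  shows "0 < u t1 x"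
proof -
  have r: "r > 0" using x(2) norm_ge_zero[of "x - q"] by linarith
  obtain \<delta> where \<delta>: "\<delta> > 0" "\<And>x. x \<in> closure \<Omega> \<Longrightarrow> norm (x - q) < \<delta> \<Longrightarrow> u t0 q / 2 \<le> u t0 x"
    by (rule positive_nearby[OF t(1) q]) (rule that; blast)
  show ?thesis
  proof (rule positivity_expanding_ball[OF t, where ?r0.0 = "min \<delta> r / 2" and r = r and m = "u t0 q / 2" and q = q])
    show "u t0 q / 2 \<le> u t0 y" if "y \<in> closure \<Omega>" "norm (y - q) \<le> min \<delta> r / 2" for y
      using \<delta>(2)[OF that(1)] that(2) \<delta>(1) r by auto
  qed (use \<delta>(1) r q x bdry in auto)
qed

lemma u_pos_interior:
  assumes "0 < t" "x \<in> \<Omega>"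
  shows "0 < u t x"
proof -
  obtain x0 where x0: "x0 \<in> closure \<Omega>" "u 0 x0 \<noteq> 0"
    using Theta sol unfolding in_Theta_def LV_solution_def by auto
  then have "u 0 x0 > 0" using u_nonneg[of 0 x0] by auto
  then obtain \<delta> where \<delta>: "\<delta> > 0" "\<And>x. x \<in> closure \<Omega> \<Longrightarrow> norm (x - x0) < \<delta> \<Longrightarrow> u 0 x0 / 2 \<le> u 0 x"
    by (rule positive_nearby[OF order.refl x0(1)]) (rule that; blast)
  obtain x1 where x1: "x1 \<in> \<Omega>" "norm (x1 - x0) < \<delta>"
    using x0(1) \<delta>(1) unfolding closure_approachable dist_norm by blast
  have x1p: "u 0 x1 > 0" using \<delta>(2)[OF in_closure[OF x1(1)] x1(2)] \<open>u 0 x0 > 0\<close> by simp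
  have nofr: "\<exists>r \<rho> g. local_C2_defining \<Omega> p r \<rho> g \<and> (p - q) \<bullet> g p \<ge> 0"
    if "p \<in> frontier \<Omega>" "norm (p - q) < r" "ball q r \<subseteq> \<Omega>" for p q r
  proof -
    have "p \<in> \<Omega>" using that by (auto simp: dist_norm norm_minus_commute)
    then show ?thesis using that(1) open_domain by (auto simp: frontier_def interior_open)
  qed
  have connected: "connected \<Omega>" using ext by (simp add: exterior_domain_def)
  have "\<forall>t>0. u t x > 0"
  proof (rule connected_induction_simple[OF connected, where a = x1 and b = x and P = "\<lambda>x. \<forall>t>0. u t x > 0"])
    obtain e where e: "e > 0" "ball x1 e \<subseteq> \<Omega>" using open_domain x1 openE by blast
    show "\<forall>t>0. u t x1 > 0"
    proof (intro allI impI)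
      fix t :: real assume "t > 0"
      then show "u t x1 > 0"
        using positivity_spreads[OF order.refl _ in_closure[OF x1(1)] x1p nofr[OF _ _ e(2)] in_closure[OF x1(1)]] e
        by simp
    qed
    fix y assume y: "y \<in> \<Omega>"
    obtain e where e: "e > 0" "ball y e \<subseteq> \<Omega>" using open_domain y openE by blast
    show "\<exists>T. openin (top_of_set \<Omega>) T \<and> y \<in> T \<and> (\<forall>x\<in>T. \<forall>y\<in>T. (\<forall>t>0. 0 < u t x) \<longrightarrow> (\<forall>t>0. 0 < u t y))"
    proof (intro exI conjI ballI allI impI)
      have sub: "ball y (e/3) \<subseteq> \<Omega>" using e by (intro subset_trans[OF _ e(2)]) auto
      then show "openin (top_of_set \<Omega>) (ball y (e/3))" by (simp add: openin_open_eq open_domain)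
      show "y \<in> ball y (e/3)" using e by simp
      fix q z and t :: real assume q: "q \<in> ball y (e/3)" and z: "z \<in> ball y (e/3)"
        and P: "\<forall>t>0. 0 < u t q" and t: "t > 0"
      have qb: "ball q (2*e/3) \<subseteq> \<Omega>"
      proof
        fix p assume "p \<in> ball q (2*e/3)"
        then have "p \<in> ball y e" using q dist_triangle[of y p q] by simp
        then show "p \<in> \<Omega>" using e by blast
      qed
      have "norm (z - q) < 2*e/3"
        using q z dist_triangle[of z q y] by (simp add: dist_norm norm_minus_commute)
      moreover have "q \<in> closure \<Omega>" "z \<in> closure \<Omega>" using q z sub in_closure by blast+
      ultimately show "0 < u t z"
        using positivity_spreads[of "t/2" t q "2*e/3" z] nofr[OF _ _ qb] P t by simp
    qed
  qed (use assms x1 in auto)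
  then show ?thesis using assms by blast
qed

text \<open>A boundary point \<open>p\<close> is reached from the interior point \<open>p - s n\<close>, \<open>n\<close> the outward unit
  normal: for small \<open>s\<close> the boundary near \<open>p\<close> is star-shaped with respect to that point.\<close>
lemma u_pos:
  assumes t: "0 < t" and x: "x \<in> closure \<Omega>"
  shows "0 < u t x"
proof (cases "x \<in> \<Omega>")
  case True
  then show ?thesis using u_pos_interior t by blast
next
  case False
  then have xf: "x \<in> frontier \<Omega>" using x open_domain by (simp add: frontier_def interior_open)
  then obtain r \<rho> g where L: "local_C2_defining \<Omega> x r \<rho> g" using C2 unfolding C2_domain_def by blast
  then obtain G where r: "r > 0" and g: "g x \<noteq> 0" and d: "(\<rho> has_derivative (\<lambda>h. g x \<bullet> h)) (at x)"
     and gd: "(g has_derivative G) (at x)"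
     and eq: "\<Omega> \<inter> ball x r = {y \<in> ball x r. \<rho> y < 0}"
    unfolding local_C2_defining_def by (metis centre_in_ball)
  have z: "\<rho> x = 0" using defining_function_frontier[OF open_domain L xf] r by simp
  define e where "e = norm (g x) / 8"
  have e: "e > 0" using g by (simp add: e_def)
  obtain b1 where b1: "b1 > 0" "\<And>y. norm (y - x) < b1 \<Longrightarrow> \<bar>\<rho> y - \<rho> x - g x \<bullet> (y - x)\<bar> \<le> e * norm (y - x)"
    using d e unfolding has_derivative_at_alt by (metis real_norm_def)
  have "isCont g x" using gd by (rule has_derivative_continuous)
  then obtain b2 where b2: "b2 > 0" "\<And>y. norm (y - x) < b2 \<Longrightarrow> norm (g y - g x) < e"
    using e unfolding continuous_at_eps_delta dist_norm by blast
  define s where "s = min r (min b1 b2) / 4"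
  have s: "s > 0" "3 * s < r" "3 * s < b1" "3 * s < b2" using r b1(1) b2(1) by (auto simp: s_def)
  define n where "n = g x /\<^sub>R norm (g x)"
  have n: "norm n = 1" "g x \<bullet> n = norm (g x)" using g by (auto simp: n_def dot_square_norm power2_eq_square)
  define q where "q = x - s *\<^sub>R n"
  have qx: "norm (q - x) = s" using s n by (simp add: q_def)
  have "\<rho> q < 0"
  proof -
    have "\<bar>\<rho> q - \<rho> x - g x \<bullet> (q - x)\<bar> \<le> e * s" using b1(2)[of q] qx s by simp
    moreover have "g x \<bullet> (q - x) = - (8 * (e * s))" using n by (simp add: q_def e_def)
    moreover have "e * s > 0" using e s by simp
    ultimately show ?thesis using z by linarith
  qed
  moreover have "q \<in> ball x r" using qx s by (simp add: dist_norm norm_minus_commute)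
  ultimately have q: "q \<in> \<Omega>" using eq by blast
  have bdry: "\<exists>r \<rho> g. local_C2_defining \<Omega> p r \<rho> g \<and> (p - q) \<bullet> g p \<ge> 0"
    if p: "p \<in> frontier \<Omega>" "norm (p - q) < 2 * s" for p
  proof -
    have px: "norm (p - x) < 3 * s"
      using norm_triangle_ineq[of "p - q" "q - x"] p(2) qx by simp
    then have pr: "p \<in> ball x r" using s by (simp add: dist_norm norm_minus_commute)
    have "\<rho> p = 0" by (rule defining_function_frontier[OF open_domain L p(1) pr])
    then have "\<bar>g x \<bullet> (p - x)\<bar> \<le> e * norm (p - x)" using b1(2)[of p] px s z by simp
    also have "\<dots> \<le> e * (3 * s)" using px e by (intro mult_left_mono) auto
    finally have 1: "\<bar>g x \<bullet> (p - x)\<bar> \<le> e * (3 * s)" .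
    have gp: "norm (g p - g x) < e" using b2(2)[of p] px s by simp
    have "\<bar>(g p - g x) \<bullet> (p - q)\<bar> \<le> norm (g p - g x) * norm (p - q)" by (rule Cauchy_Schwarz_ineq2)
    also have "\<dots> \<le> e * (2 * s)" using gp p(2) e by (intro mult_mono) auto
    finally have 2: "\<bar>(g p - g x) \<bullet> (p - q)\<bar> \<le> e * (2 * s)" .
    have "g x \<bullet> (p - q) = g x \<bullet> (p - x) + 8 * (e * s)"
      using n by (simp add: q_def e_def inner_diff_right)
    moreover have "g p \<bullet> (p - q) = (g p - g x) \<bullet> (p - q) + g x \<bullet> (p - q)" by (simp add: inner_diff_left)
    moreover have "e * s > 0" using e s by simp
    moreover have "e * (3 * s) = 3 * (e * s)" "e * (2 * s) = 2 * (e * s)" by auto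
    ultimately have "g p \<bullet> (p - q) \<ge> 0" using 1 2 by linarith
    then show ?thesis using local_C2_defining_shift[OF L pr] by (metis inner_commute)
  qed
  show ?thesis
  proof (rule positivity_spreads[of "t/2" t q "2 * s" x])
    show "norm (x - q) < 2 * s" using qx s by (simp add: norm_minus_commute)
    show "0 < u (t/2) q" using u_pos_interior q t by simp
  qed (use t x in_closure[OF q] bdry in auto)
qed

end

section \<open>Lower bounds in expanding balls\<close>

lemma laplace_on_radial_cutoff:
  fixes L :: real
  shows "laplace_on UNIV (\<lambda>x::'a::euclidean_space. (max 0 ((norm x)\<^sup>2 - L\<^sup>2))^3)
    (\<lambda>x. (6 * (max 0 ((norm x)\<^sup>2 - L\<^sup>2))\<^sup>2) *\<^sub>R x)
    (\<lambda>x. 24 * max 0 ((norm x)\<^sup>2 - L\<^sup>2) * (norm x)\<^sup>2 + 6 * real DIM('a) * (max 0 ((norm x)\<^sup>2 - L\<^sup>2))\<^sup>2)"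
proof -
  have "laplace_on UNIV (\<lambda>x::'a. (norm (x - 0))\<^sup>2 + (- L\<^sup>2)) (\<lambda>x. 2 *\<^sub>R (x - 0) + 0) (\<lambda>x. 2 * real DIM('a) + 0)"
    by (intro laplace_on_add laplace_on_norm2 laplace_on_const)
  from laplace_on_max0_cube[OF this] show ?thesis
    by (rule laplace_on_cong[OF open_UNIV]) (auto simp: power_mult_distrib)
qed

lemma laplace_on_const_minus_radial_cutoff:
  fixes L :: real
  shows "laplace_on UNIV (\<lambda>x::'a::euclidean_space. m - A * (max 0 ((norm x)\<^sup>2 - L\<^sup>2))^3)
    (\<lambda>x. (- A * (6 * (max 0 ((norm x)\<^sup>2 - L\<^sup>2))\<^sup>2)) *\<^sub>R x)
    (\<lambda>x. - A * (24 * max 0 ((norm x)\<^sup>2 - L\<^sup>2) * (norm x)\<^sup>2 + 6 * real DIM('a) * (max 0 ((norm x)\<^sup>2 - L\<^sup>2))\<^sup>2))"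
  by (rule laplace_on_cong[OF open_UNIV laplace_on_add[OF laplace_on_const[of UNIV m]
        laplace_on_cmult[OF laplace_on_radial_cutoff[of L], of "- A"]]]) auto

lemma radial_cutoff_continuous:
  assumes "continuous_on UNIV m"
  shows "continuous_on UNIV (\<lambda>(t::real, x::'a::euclidean_space). m t - A * (max 0 ((norm x)\<^sup>2 - L\<^sup>2))^3)"
  unfolding case_prod_unfold
  by (intro continuous_intros continuous_on_compose2[OF assms]) auto

text \<open>Where \<open>z\<close> is below \<open>\<alpha>\<close> it is pushed up at rate \<open>2 * \<sigma>\<close>; the comparison function rises at
  rate \<open>\<sigma>\<close> and is cut off radially between \<open>c1 * t0\<close> and \<open>c' * t0\<close>, which costs a Laplacian of
  order \<open>1 / t0^2\<close> only.\<close>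
lemma eventually_lifted:
  fixes \<Omega> :: "'a::euclidean_space set"
  assumes ext: "exterior_domain \<Omega>" and C2: "C2_domain \<Omega>" and d: "d > 0"
    and z: "classical_neumann_eq \<Omega> d f z"
    and cz: "continuous_on ({0..} \<times> closure \<Omega>) (\<lambda>(t,x). z t x)"
    and bnd: "\<And>t x. 0 \<le> t \<Longrightarrow> x \<in> closure \<Omega> \<Longrightarrow> - M \<le> z t x"
    and c: "0 < c" "c < c'" and \<sigma>: "\<sigma> > 0"
    and push: "eventually (\<lambda>t. \<forall>x\<in>\<Omega>. norm x \<le> c' * t \<longrightarrow> z t x < \<alpha> \<longrightarrow> f t x \<ge> 2 * \<sigma>) at_top"
  shows "eventually (\<lambda>t. \<forall>x\<in>closure \<Omega>. norm x \<le> c * t \<longrightarrow> z t x \<ge> \<alpha>) at_top"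
proof (cases "\<alpha> \<le> - M")
  case True
  have "\<forall>x\<in>closure \<Omega>. norm x \<le> c * t \<longrightarrow> z t x \<ge> \<alpha>" if "t \<ge> 0" for t
    using bnd[OF that] True by fastforce
  then show ?thesis by (rule eventually_at_top_linorderI)
next
  case False
  define D where "D = \<alpha> + M"
  have D: "D > 0" using False by (simp add: D_def)
  obtain T where T: "\<And>t x. t \<ge> T \<Longrightarrow> x \<in> \<Omega> \<Longrightarrow> norm x \<le> c' * t \<Longrightarrow> z t x < \<alpha> \<Longrightarrow> f t x \<ge> 2 * \<sigma>"
    using push unfolding eventually_at_top_linorder by blast
  obtain R where R: "R > 0" "\<And>x. x \<notin> \<Omega> \<Longrightarrow> norm x < R"
      "\<And>x. x \<in> frontier \<Omega> \<Longrightarrow> norm x < R" "compact (frontier \<Omega>)"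
    by (rule exterior_domain_frontier[OF ext]) (rule that; blast)
  define \<tau> where "\<tau> = D / \<sigma>"
  have \<tau>: "\<tau> > 0" "\<sigma> * \<tau> = D" using D \<sigma> by (auto simp: \<tau>_def)
  define c1 where "c1 = (c + c') / 2"
  have c1: "c < c1" "c1 < c'" "c1 > 0" "c' > 0" using c by (auto simp: c1_def)
  define \<kappa> where "\<kappa> = c'\<^sup>2 - c1\<^sup>2"
  have \<kappa>: "\<kappa> > 0" using c1 by (simp add: \<kappa>_def power_strict_mono)
  define N where "N = real DIM('a)"
  define H where "H = d * (D / \<kappa>^3) * ((24 + 6 * N) * c'^4)"
  have H: "H \<ge> 0" using d D \<kappa> by (simp add: H_def N_def)
  define T1 where "T1 = Max {T, 1, R / c1, H / \<sigma>, c * \<tau> / (c1 - c)}"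
  have main: "z (t0 + \<tau>) x \<ge> \<alpha>" if t0: "t0 \<ge> T1" and x: "x \<in> closure \<Omega>" "norm x \<le> c1 * t0" for t0 x
  proof -
    have t0': "t0 \<ge> T" "t0 \<ge> 1" "t0 \<ge> R / c1" "t0 \<ge> H / \<sigma>" using t0 by (auto simp: T1_def)
    define L where "L = c1 * t0"
    define L' where "L' = c' * t0"
    have LL: "L'\<^sup>2 - L\<^sup>2 = \<kappa> * t0\<^sup>2" by (simp add: L_def L'_def \<kappa>_def power_mult_distrib algebra_simps)
    have LR: "R \<le> L" using t0'(3) c1 by (simp add: L_def pos_divide_le_eq mult.commute)
    have Lpos: "0 < L" "0 < L'" using c1 t0' by (auto simp: L_def L'_def)
    have kt: "\<kappa> * t0\<^sup>2 > 0" using \<kappa> t0' by simp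
    define A where "A = D / (\<kappa> * t0\<^sup>2)^3"
    have A: "A > 0" using D kt by (simp add: A_def)
    define s where "s = (\<lambda>x::'a. max 0 ((norm x)\<^sup>2 - L\<^sup>2))"
    define w where "w = (\<lambda>t x. (- M + \<sigma> * (t - t0)) - A * (s x)^3)"
    define gw where "gw = (\<lambda>x. (- A * (6 * (s x)\<^sup>2)) *\<^sub>R x)"
    define Lw where "Lw = (\<lambda>x. - A * (24 * s x * (norm x)\<^sup>2 + 6 * real DIM('a) * (s x)\<^sup>2))"
    have s0: "s y \<ge> 0" for y by (simp add: s_def)
    have wle: "w t y \<le> \<alpha>" if "t \<le> t0 + \<tau>" for t y
    proof -
      have "\<sigma> * (t - t0) \<le> \<sigma> * \<tau>" using that \<sigma> by (intro mult_left_mono) auto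
      moreover have "A * s y ^ 3 \<ge> 0" using A s0[of y] by simp
      ultimately show ?thesis using \<tau>(2) by (simp add: w_def D_def)
    qed
    have far: "w t y \<le> - M" if "t \<le> t0 + \<tau>" "norm y \<ge> L'" for t y
    proof -
      have "L'\<^sup>2 \<le> (norm y)\<^sup>2" using that Lpos by (intro power_mono) auto
      then have "\<kappa> * t0\<^sup>2 \<le> s y" using LL by (simp add: s_def)
      then have "(\<kappa> * t0\<^sup>2)^3 \<le> s y ^ 3" using kt by (intro power_mono) auto
      then have "A * (\<kappa> * t0\<^sup>2)^3 \<le> A * s y ^ 3" using A by (intro mult_left_mono) auto
      moreover have "A * (\<kappa> * t0\<^sup>2)^3 = D" using kt by (simp add: A_def del: power_mult_distrib) auto
      ultimately have "D \<le> A * s y ^ 3" by simp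
      moreover have "\<sigma> * (t - t0) \<le> \<sigma> * \<tau>" using that \<sigma> by (intro mult_left_mono) auto
      ultimately show ?thesis using \<tau>(2) by (simp add: w_def)
    qed
    have "w (t0 + \<tau>) x \<le> z (t0 + \<tau>) x"
    proof (rule neumann_comparison[OF ext C2 d z cz, where ?t0.0 = t0 and w = w and wt = "\<lambda>t x. \<sigma>"
          and gw = "\<lambda>t. gw" and Lw = "\<lambda>t. Lw" and B = D and G = 0 and ?t1.0 = "t0 + \<tau>"])
      show "continuous_on UNIV (\<lambda>(t, x). w t x)"
        unfolding w_def s_def by (rule radial_cutoff_continuous) (intro continuous_intros)
      show "((\<lambda>s. w s x) has_real_derivative \<sigma>) (at t)" for t x
        unfolding w_def by (auto intro!: derivative_eq_intros)
      show "laplace_on UNIV (w t) gw Lw" for t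
        unfolding w_def gw_def Lw_def s_def by (rule laplace_on_const_minus_radial_cutoff)
    next
      fix t y assume t: "t0 \<le> t" "t \<le> t0 + \<tau>" and y: "y \<in> closure \<Omega>"
      show "- D \<le> z t y - w t y" using bnd[OF _ y, of t] wle[OF t(2), of y] t t0' by (simp add: D_def)
    next
      fix y assume y: "y \<in> closure \<Omega>"
      have "A * s y ^ 3 \<ge> 0" using A s0[of y] by simp
      then show "w t0 y \<le> z t0 y" using bnd[OF _ y, of t0] t0' by (simp add: w_def)
    next
      fix t y assume t: "t0 < t" "t \<le> t0 + \<tau>" and y: "y \<in> \<Omega>" and lt: "z t y < w t y"
      have y': "y \<in> closure \<Omega>" using y closure_subset by blast
      have yL: "norm y < L'" using far[OF t(2), of y] bnd[OF _ y', of t] lt t t0' by force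
      have "L' \<le> c' * t" using t c1 by (simp add: L'_def)
      then have f: "f t y \<ge> 2 * \<sigma>" using T[OF _ y, of t] t t0' yL lt wle[OF t(2), of y] by auto
      have "(norm y)\<^sup>2 \<le> L'\<^sup>2" using yL by (intro power_mono) auto
      moreover from this have sL: "s y \<le> L'\<^sup>2" using zero_le_power2[of L] unfolding s_def
        by (intro max.boundedI) (simp, linarith)
      ultimately have "s y * (norm y)\<^sup>2 \<le> L'\<^sup>2 * L'\<^sup>2" by (intro mult_mono) auto
      moreover have "(s y)\<^sup>2 \<le> (L'\<^sup>2)\<^sup>2" by (rule power_mono[OF sL s0])
      ultimately have sy: "s y * (norm y)\<^sup>2 \<le> L'^4" "(s y)\<^sup>2 \<le> L'^4" by simp_all
      have "6 * N * (s y)\<^sup>2 \<le> 6 * N * L'^4" by (rule mult_left_mono[OF sy(2)]) (simp add: N_def)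
      moreover have "24 * s y * (norm y)\<^sup>2 \<le> 24 * L'^4" using sy(1) by simp
      ultimately have "24 * s y * (norm y)\<^sup>2 + 6 * N * (s y)\<^sup>2 \<le> 24 * L'^4 + 6 * N * L'^4"
        by (rule add_mono[rotated])
      then have "d * (A * (24 * s y * (norm y)\<^sup>2 + 6 * N * (s y)\<^sup>2)) \<le> d * (A * (24 * L'^4 + 6 * N * L'^4))"
        using d A by (intro mult_left_mono) auto
      then have "- (d * Lw y) \<le> d * (A * (24 * L'^4 + 6 * N * L'^4))"
        by (simp add: Lw_def N_def)
      also have "\<dots> = H / t0\<^sup>2"
      proof -
        have "L'^4 = c'^4 * t0^4" by (simp add: L'_def power_mult_distrib)
        moreover have t6: "t0^6 = t0^4 * t0\<^sup>2" by (simp flip: power_add)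
        ultimately show ?thesis
          using t0' \<kappa> by (simp add: A_def H_def field_simps) (simp only: t6 mult_ac)
      qed
      also have "\<dots> \<le> H / t0" using t0' H by (intro divide_left_mono) (auto simp: power2_eq_square)
      also have "\<dots> \<le> \<sigma>" using t0' \<sigma> by (simp add: pos_divide_le_eq mult.commute)
      finally show "0 * (z t y - w t y) \<le> f t y - (\<sigma> - d * Lw y)" using f by simp
    next
      fix t p assume t: "t0 < t" "t \<le> t0 + \<tau>" and p: "p \<in> frontier \<Omega>"
      have "norm p \<le> L" using R(3)[OF p] LR by simp
      then have "(norm p)\<^sup>2 \<le> L\<^sup>2" by (intro power_mono) auto
      then have "gw p = 0" by (simp add: gw_def s_def)
      then show "\<exists>r \<rho> g. local_C2_defining \<Omega> p r \<rho> g \<and> gw p \<bullet> g p \<le> 0"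
        using C2 p unfolding C2_domain_def by auto
    qed (use t0' \<tau> x in auto)
    moreover have "(norm x)\<^sup>2 \<le> L\<^sup>2" using x by (intro power_mono) (auto simp: L_def)
    then have "s x = 0" by (simp add: s_def)
    ultimately show ?thesis using \<tau>(2) by (simp add: w_def D_def)
  qed
  show ?thesis
  proof (rule eventually_at_top_linorderI[of "T1 + \<tau>"], intro ballI impI)
    fix t x assume t: "T1 + \<tau> \<le> t" and x: "x \<in> closure \<Omega>" "norm x \<le> c * t"
    have "c * \<tau> / (c1 - c) \<le> T1" by (simp add: T1_def)
    then have "c * \<tau> / (c1 - c) \<le> t - \<tau>" using t by linarith
    then have "c * \<tau> \<le> (t - \<tau>) * (c1 - c)" using c1 by (simp add: pos_divide_le_eq)
    then have "c * t \<le> c1 * (t - \<tau>)" by (simp add: algebra_simps)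
    then show "\<alpha> \<le> z t x" using main[of "t - \<tau>" x] t x by simp
  qed
qed

context competition_system
begin

lemma u_compact_lower_bound:
  assumes "0 < t"
  obtains m where "m > 0" "\<And>x. x \<in> closure \<Omega> \<Longrightarrow> norm x \<le> R \<Longrightarrow> m \<le> u t x"
proof (cases "closure \<Omega> \<inter> cball 0 R = {}")
  case True
  show thesis by (rule that[of 1]) (use True in auto)
next
  case False
  have "compact (closure \<Omega> \<inter> cball 0 R)" by (intro closed_Int_compact) auto
  moreover have "continuous_on (closure \<Omega> \<inter> cball 0 R) (u t)"
    using cont_u_at[of t] assms by (auto intro: continuous_on_subset)
  ultimately obtain x0 where "x0 \<in> closure \<Omega> \<inter> cball 0 R" "\<And>x. x \<in> closure \<Omega> \<inter> cball 0 R \<Longrightarrow> u t x0 \<le> u t x"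
    using continuous_attains_inf[of "closure \<Omega> \<inter> cball 0 R" "u t"] False by blast
  then show thesis using that[of "u t x0"] u_pos[OF assms, of x0] by auto
qed

text \<open>Bumps travelling radially outwards at speed at most \<open>c\<close>, started on the sphere of radius
  \<open>Q\<close> around the obstacle, stay below \<open>u\<close>.\<close>
lemma u_lower_bound_far:
  assumes c: "0 < c" "c\<^sup>2 < 4 * d1 * r1 * (1 - a1)"
  obtains \<delta> Q where "\<delta> > 0" "Q \<ge> c" "\<And>x. x \<in> frontier \<Omega> \<Longrightarrow> norm x < Q"
    "\<And>t x. t \<ge> 1 \<Longrightarrow> x \<in> closure \<Omega> \<Longrightarrow> Q \<le> norm x \<Longrightarrow> norm x \<le> Q + c * (t - 1) \<Longrightarrow> \<delta> \<le> u t x"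
proof -
  obtain R0 where R0: "R0 > 0" "\<And>x. x \<notin> \<Omega> \<Longrightarrow> norm x < R0"
      "\<And>x. x \<in> frontier \<Omega> \<Longrightarrow> norm x < R0" "compact (frontier \<Omega>)"
    by (rule exterior_domain_frontier[OF ext]) (rule that; blast)
  define \<mu> where "\<mu> = (c\<^sup>2 / (4 * d1) + r1 * (1 - a1)) / 2"
  define P where "P = \<mu> - c\<^sup>2 / (4 * d1)"
  have "c\<^sup>2 / (4 * d1) < r1 * (1 - a1)" 
  proof -
    have "c\<^sup>2 < r1 * (1 - a1) * (4 * d1)" using c(2) by (simp add: algebra_simps)
    then show ?thesis using pos by (subst pos_divide_less_eq) auto
  qed
  then have P: "P > 0" and \<mu>: "\<mu> < r1 * (1 - a1)" by (auto simp: P_def \<mu>_def)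
  define \<nu> where "\<nu> = (1 - a1) - \<mu> / r1"
  have \<nu>: "\<nu> > 0" using \<mu> pos by (simp add: \<nu>_def pos_divide_less_eq mult.commute)
  define a where "a = 3 * 0 + 6 * d1 * real DIM('a) + 24 * d1"
  define R where "R = 1 + a\<^sup>2 / (96 * d1 * P)"
  have R: "R \<ge> 1" using pos P by (simp add: R_def)
  have quad: "a\<^sup>2 \<le> 96 * d1 * P * R\<^sup>2"
  proof -
    have "a\<^sup>2 / (96 * d1 * P) \<le> R" by (simp add: R_def)
    also have "\<dots> \<le> R\<^sup>2" using R by (simp add: power2_eq_square)
    finally show ?thesis using pos P by (simp add: pos_divide_le_eq mult_ac)
  qed
  define Q where "Q = R0 + R + c"
  obtain m where m: "m > 0" "\<And>x. x \<in> closure \<Omega> \<Longrightarrow> norm x \<le> Q + R \<Longrightarrow> m \<le> u 1 x"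
    by (rule u_compact_lower_bound[OF zero_less_one, of "Q + R"]) (rule that; blast)
  define \<theta> where "\<theta> = min (min m \<nu>) 1"
  have \<theta>: "\<theta> > 0" "\<theta> \<le> m" "\<theta> \<le> \<nu>" "\<theta> \<le> 1" using m(1) \<nu> by (auto simp: \<theta>_def)
  define \<epsilon> where "\<epsilon> = \<theta> / (exp (c * R / (2 * d1)) * (R\<^sup>2)^3)"
  have R2: "R\<^sup>2 > 0" using R by simp
  have \<epsilon>: "\<epsilon> > 0" using \<theta> R2 by (simp add: \<epsilon>_def)
  show thesis
  proof (rule that[of "\<epsilon> * (R\<^sup>2)^3" Q])
    show "\<epsilon> * (R\<^sup>2)^3 > 0" using \<epsilon> R2 by simp
    show "Q \<ge> c" using R0 R by (simp add: Q_def)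
    show "norm x < Q" if "x \<in> frontier \<Omega>" for x using R0(3)[OF that] R c by (simp add: Q_def)
  next
    fix t x assume t: "(1::real) \<le> t" and x: "x \<in> closure \<Omega>" "Q \<le> norm x" "norm x \<le> Q + c * (t - 1)"
    have xpos: "norm x > 0" "Q > 0" using x R0 R c by (auto simp: Q_def)
    define e where "e = x /\<^sub>R norm x"
    have e: "norm e = 1" using xpos by (simp add: e_def)
    define ck where "ck = (if t = 1 then 0 else (norm x - Q) / (t - 1))"
    have ck: "0 \<le> ck" "ck \<le> c" using x t c by (auto simp: ck_def divide_le_eq mult.commute)
    have ckt: "(t - 1) * ck = norm x - Q" using x t by (auto simp: ck_def)
    define q where "q = Q *\<^sub>R e"
    define k where "k = ck *\<^sub>R e"
    have nk: "norm k = ck" using e ck by (simp add: k_def)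
    have center: "q + (t - 1) *\<^sub>R k = x"
    proof -
      have "q + (t - 1) *\<^sub>R k = (Q + (t - 1) * ck) *\<^sub>R e" by (simp add: q_def k_def algebra_simps)
      then show ?thesis using ckt xpos by (simp add: e_def)
    qed
    have ncenter: "norm (q + (s - 1) *\<^sub>R k) \<ge> Q" if "s \<ge> 1" for s
    proof -
      have "q + (s - 1) *\<^sub>R k = (Q + (s - 1) * ck) *\<^sub>R e" by (simp add: q_def k_def algebra_simps)
      then show ?thesis using e ck that xpos by simp
    qed
    define w where "w = bump d1 \<epsilon> 0 0 k q (R\<^sup>2) 1"
    have weq: "w s y = \<epsilon> * exp (- (k \<bullet> (y - (q + (s - 1) *\<^sub>R k))) / (2 * d1))
         * (max 0 (R\<^sup>2 - (norm (y - (q + (s - 1) *\<^sub>R k)))\<^sup>2))^3" for s y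
      by (simp add: w_def bump_def)
    have w0: "w s y \<ge> 0" for s y using \<epsilon> by (simp add: w_def bump_nonneg)
    have supp: "norm (y - (q + (s - 1) *\<^sub>R k)) < R" if "w s y > 0" for s y
    proof (rule ccontr)
      assume "\<not> ?thesis"
      then have "R\<^sup>2 \<le> (norm (y - (q + (s - 1) *\<^sub>R k)))\<^sup>2" using R by (intro power_mono) auto
      then show False using that by (simp add: weq)
    qed
    have wle: "w s y \<le> \<theta>" for s y
    proof (cases "w s y > 0")
      case False
      then show ?thesis using \<theta> by simp
    next
      case True
      define h where "h = y - (q + (s - 1) *\<^sub>R k)"
      have h: "norm h < R" using supp[OF True] by (simp add: h_def)
      have "- (k \<bullet> h) \<le> norm k * norm h" using Cauchy_Schwarz_ineq2[of k h] by linarith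
      also have "\<dots> \<le> c * R" using h ck nk R by (intro mult_mono) auto
      finally have "- (k \<bullet> h) / (2 * d1) \<le> c * R / (2 * d1)" using pos by (intro divide_right_mono) auto
      then have 1: "exp (- (k \<bullet> h) / (2 * d1)) \<le> exp (c * R / (2 * d1))" by (simp only: exp_le_cancel_iff)
      have 2: "(max 0 (R\<^sup>2 - (norm h)\<^sup>2))^3 \<le> (R\<^sup>2)^3" by (intro power_mono) auto
      have "w s y = \<epsilon> * (exp (- (k \<bullet> h) / (2 * d1)) * (max 0 (R\<^sup>2 - (norm h)\<^sup>2))^3)"
        by (simp add: weq h_def)
      also have "\<dots> \<le> \<epsilon> * (exp (c * R / (2 * d1)) * (R\<^sup>2)^3)"
        using 1 2 \<epsilon> by (intro mult_left_mono mult_mono) auto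
      also have "\<dots> = \<theta>" using R by (simp add: \<epsilon>_def)
      finally show ?thesis .
    qed
    have k2: "(norm k)\<^sup>2 / (4 * d1) \<le> c\<^sup>2 / (4 * d1)"
      using nk ck pos by (intro divide_right_mono power_mono) auto
    obtain wt gw Lw where W:
      "\<And>t x. ((\<lambda>s. w s x) has_real_derivative wt t x) (at t)"
      "\<And>t. laplace_on UNIV (w t) (gw t) (Lw t)"
      "\<And>t x. 1 \<le> t \<Longrightarrow> wt t x - d1 * Lw t x \<le> \<mu> * w t x"
    proof (rule bump_subsolution[where d = d1 and \<epsilon> = \<epsilon> and K = 0 and \<beta> = 0 and k = k
          and \<sigma> = "R\<^sup>2" and P = P and \<mu> = \<mu> and q = q and ?t0.0 = 1])
      show "P \<le> \<mu> - 0 - (norm k)\<^sup>2 / (4 * d1)" using k2 by (simp add: P_def)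
      show "(3 * 0 + 6 * d1 * real DIM('a) + 24 * d1)\<^sup>2 \<le> 96 * d1 * P * R\<^sup>2" using quad by (simp add: a_def)
    qed (use that pos \<epsilon> P in \<open>auto simp: w_def\<close>)
    have "w t x \<le> u t x"
    proof (rule neumann_comparison[OF ext C2 pos(1) eq_u cont_u zero_le_one _ W(1,2), where B = 1 and G = \<mu> and ?t1.0 = t])
      show "continuous_on UNIV (\<lambda>(t, x). w t x)" unfolding w_def by (rule bump_continuous)
    next
      fix s y assume s: "1 \<le> s" "s \<le> t" and y: "y \<in> closure \<Omega>"
      show "- 1 \<le> u s y - w s y" using u_nonneg[of s y] wle[of s y] \<theta> s y by simp
    next
      fix y assume y: "y \<in> closure \<Omega>"
      show "w 1 y \<le> u 1 y"
      proof (cases "w 1 y > 0")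
        case False
        then show ?thesis using u_nonneg[of 1 y] y by simp
      next
        case True
        have "norm (y - q) < R" using supp[OF True] by simp
        moreover have "norm q = Q" using e xpos by (simp add: q_def)
        ultimately have "norm y \<le> Q + R" using norm_triangle_ineq[of "y - q" q] by simp
        then show ?thesis using m(2)[OF y] wle[of 1 y] \<theta> by linarith
      qed
    next
      fix s y assume s: "1 < s" "s \<le> t" and y: "y \<in> \<Omega>" and lt: "u s y < w s y"
      have y': "y \<in> closure \<Omega>" by (rule in_closure[OF y])
      have s0: "0 \<le> s" using s by simp
      have "a1 * v s y \<le> a1" using v_le_1[OF s0 y'] pos by simp
      then have "1 - u s y - a1 * v s y \<ge> \<mu> / r1"
        using lt wle[of s y] \<theta> by (simp add: \<nu>_def)
      then have "r1 * u s y * (1 - u s y - a1 * v s y) \<ge> r1 * u s y * (\<mu> / r1)"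
        using pos u_nonneg[OF s0 y'] by (intro mult_left_mono) auto
      moreover have "r1 * u s y * (\<mu> / r1) = \<mu> * u s y" using pos by simp
      moreover have "wt s y - d1 * Lw s y \<le> \<mu> * w s y" using W(3) s by simp
      ultimately show "\<mu> * (u s y - w s y) \<le> r1 * u s y * (1 - u s y - a1 * v s y) - (wt s y - d1 * Lw s y)"
        by (simp add: right_diff_distrib)
    next
      fix s p assume s: "1 < s" "s \<le> t" and p: "p \<in> frontier \<Omega>" and lt: "u s p < w s p"
      have "p \<in> closure \<Omega>" using p by (simp add: frontier_def)
      then have "w s p > 0" using lt u_nonneg[of s p] s by auto
      then have "norm (p - (q + (s - 1) *\<^sub>R k)) < R" by (rule supp)
      then have "norm (q + (s - 1) *\<^sub>R k) < norm p + R"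
        using norm_triangle_ineq3[of p "q + (s - 1) *\<^sub>R k"] by linarith
      then show "\<exists>r \<rho> g. local_C2_defining \<Omega> p r \<rho> g \<and> gw s p \<bullet> g p \<le> 0"
        using ncenter[of s] s R0(3)[OF p] c by (simp add: Q_def)
    qed (use t x in auto)
    moreover have "w t x = \<epsilon> * (R\<^sup>2)^3" unfolding weq center by simp
    ultimately show "\<epsilon> * (R\<^sup>2)^3 \<le> u t x" by simp
  qed
qed

lemma u_lower_bound:
  assumes c: "0 < c" "c\<^sup>2 < 4 * d1 * r1 * (1 - a1)"
  obtains \<delta> where "\<delta> > 0" "eventually (\<lambda>t. \<forall>x\<in>closure \<Omega>. norm x \<le> c * t \<longrightarrow> \<delta> \<le> u t x) at_top"
proof -
  obtain \<delta> Q where Q: "\<delta> > 0" "Q \<ge> c" "\<And>x. x \<in> frontier \<Omega> \<Longrightarrow> norm x < Q"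
    "\<And>t x. t \<ge> 1 \<Longrightarrow> x \<in> closure \<Omega> \<Longrightarrow> Q \<le> norm x \<Longrightarrow> norm x \<le> Q + c * (t - 1) \<Longrightarrow> \<delta> \<le> u t x"
    by (rule u_lower_bound_far[OF c]) (rule that; blast)
  define T where "T = 1 + 1 / c"
  have T: "T > 1" "c * (T - 1) = 1" using c by (auto simp: T_def)
  have cT: "c * (t - 1) \<ge> 1" if "t \<ge> T" for t
    using mult_left_mono[of "T - 1" "t - 1" c] that c T by simp
  obtain m where m: "m > 0" "\<And>x. x \<in> closure \<Omega> \<Longrightarrow> norm x \<le> Q + 1 \<Longrightarrow> m \<le> u T x"
  proof (rule u_compact_lower_bound[of T "Q + 1"])
    show "0 < T" using T by simp
  qed (rule that; blast)
  define \<eta> where "\<eta> = min (min \<delta> m) (1 - a1)"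
  have \<eta>: "\<eta> > 0" "\<eta> \<le> \<delta>" "\<eta> \<le> m" "\<eta> \<le> 1 - a1" using Q(1) m(1) pos by (auto simp: \<eta>_def)
  have Qp: "Q > 0" using Q(2) c by simp
  define \<kappa> where "\<kappa> = (Q + 1)\<^sup>2 - Q\<^sup>2"
  have \<kappa>: "\<kappa> > 0" using Qp by (simp add: \<kappa>_def power_strict_mono)
  define A where "A = \<eta> / \<kappa>^3"
  have A: "A > 0" using \<eta> \<kappa> by (simp add: A_def)
  define s where "s = (\<lambda>x::'a. max 0 ((norm x)\<^sup>2 - Q\<^sup>2))"
  define w where "w = (\<lambda>(t::real) x. \<eta> - A * (s x)^3)"
  define gw where "gw = (\<lambda>x. (- A * (6 * (s x)\<^sup>2)) *\<^sub>R x)"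
  define Lw where "Lw = (\<lambda>x. - A * (24 * s x * (norm x)\<^sup>2 + 6 * real DIM('a) * (s x)\<^sup>2))"
  have sz: "s x = 0" if "norm x \<le> Q" for x
  proof -
    have "(norm x)\<^sup>2 \<le> Q\<^sup>2" using that by (intro power_mono) auto
    then show ?thesis by (simp add: s_def)
  qed
  have wle: "w t x \<le> \<eta>" for t x using A by (simp add: w_def s_def)
  have far: "w t x \<le> 0" if "norm x \<ge> Q + 1" for t x
  proof -
    have "(Q + 1)\<^sup>2 \<le> (norm x)\<^sup>2" using that Qp by (intro power_mono) auto
    then have "\<kappa> \<le> s x" by (simp add: s_def \<kappa>_def)
    then have "\<kappa>^3 \<le> (s x)^3" using \<kappa> by (intro power_mono) auto
    then have "A * \<kappa>^3 \<le> A * (s x)^3" using A by (intro mult_left_mono) auto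
    then show ?thesis using \<kappa> by (simp add: w_def A_def)
  qed
  have main: "\<eta> \<le> u t x" if t: "t \<ge> T" and x: "x \<in> closure \<Omega>" "norm x \<le> Q" for t x
  proof -
    have "w t x \<le> u t x"
    proof (rule neumann_comparison[OF ext C2 pos(1) eq_u cont_u, where ?t0.0 = T and w = w and wt = "\<lambda>t x. 0"
          and gw = "\<lambda>t. gw" and Lw = "\<lambda>t. Lw" and B = \<eta> and G = 0 and ?t1.0 = t])
      show "continuous_on UNIV (\<lambda>(t, x). w t x)"
        unfolding w_def s_def by (rule radial_cutoff_continuous) (intro continuous_intros)
      show "((\<lambda>s. w s x) has_real_derivative 0) (at t)" for t x
        unfolding w_def by (auto intro!: derivative_eq_intros)
      show "laplace_on UNIV (w t) gw Lw" for t
        unfolding w_def gw_def Lw_def s_def by (rule laplace_on_const_minus_radial_cutoff)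
    next
      fix t' y assume "T \<le> t'" "y \<in> closure \<Omega>"
      then show "- \<eta> \<le> u t' y - w t' y" using u_nonneg[of t' y] wle[of t' y] T by simp
    next
      fix y assume y: "y \<in> closure \<Omega>"
      show "w T y \<le> u T y"
        using m(2)[OF y] wle[of T y] \<eta> far[of y T] u_nonneg[of T y] T y by (cases "norm y \<le> Q + 1") auto
    next
      fix t' y assume t': "T < t'" and y: "y \<in> \<Omega>" and lt: "u t' y < w t' y"
      have y': "y \<in> closure \<Omega>" by (rule in_closure[OF y])
      have t0: "0 \<le> t'" using t' T by simp
      have "norm y < Q + 1" using far[of y t'] lt u_nonneg[OF t0 y'] by force
      then have "\<not> Q \<le> norm y"
        using Q(4)[of t' y] y' t' T cT[of t'] lt wle[of t' y] \<eta> by auto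
      then have "Lw y = 0" using sz[of y] by (simp add: Lw_def)
      moreover have "a1 * v t' y \<le> a1" using v_le_1[OF t0 y'] pos by simp
      then have "0 \<le> 1 - u t' y - a1 * v t' y" using lt wle[of t' y] \<eta> by linarith
      then have "0 \<le> r1 * u t' y * (1 - u t' y - a1 * v t' y)"
        using pos u_nonneg[OF t0 y'] by simp
      ultimately show "0 * (u t' y - w t' y) \<le> r1 * u t' y * (1 - u t' y - a1 * v t' y) - (0 - d1 * Lw y)"
        by simp
    next
      fix p assume p: "p \<in> frontier \<Omega>"
      have "gw p = 0" using sz[of p] Q(3)[OF p] by (simp add: gw_def)
      then show "\<exists>r \<rho> g. local_C2_defining \<Omega> p r \<rho> g \<and> gw p \<bullet> g p \<le> 0"
        using C2 p unfolding C2_domain_def by auto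
    qed (use t T x in auto)
    then show ?thesis using sz[OF x(2)] by (simp add: w_def)
  qed
  show thesis
  proof (rule that[OF \<eta>(1)], rule eventually_at_top_linorderI[of T], intro ballI impI)
    fix t x assume t: "T \<le> t" and x: "x \<in> closure \<Omega>" "norm x \<le> c * t"
    show "\<eta> \<le> u t x"
    proof (cases "norm x \<le> Q")
      case True
      then show ?thesis using main t x by blast
    next
      case False
      have "norm x \<le> Q + c * (t - 1)" using x(2) Q(2) by (simp add: algebra_simps)
      then show ?thesis using Q(4)[of t x] False t T x(1) \<eta> by auto
    qed
  qed
qed

end

section \<open>Convergence and spreading speeds\<close>

context competition_system
begin

definition "speed = 2 * sqrt (d1 * r1 * (1 - a1))"

definition u_eventually_ge :: "real \<Rightarrow> bool" where
  "u_eventually_ge \<alpha> \<longleftrightarrow> (\<forall>c. 0 < c \<and> c < speed \<longrightarrow>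
     eventually (\<lambda>t. \<forall>x\<in>closure \<Omega>. norm x \<le> c * t \<longrightarrow> \<alpha> \<le> u t x) at_top)"

definition v_eventually_le :: "real \<Rightarrow> bool" where
  "v_eventually_le \<beta> \<longleftrightarrow> (\<forall>c. 0 < c \<and> c < speed \<longrightarrow>
     eventually (\<lambda>t. \<forall>x\<in>closure \<Omega>. norm x \<le> c * t \<longrightarrow> v t x \<le> \<beta>) at_top)"

lemma speed_pos: "speed > 0"
  using pos by (simp add: speed_def)

lemma below_speed:
  assumes "0 < c" "c < speed"
  shows "c\<^sup>2 < 4 * d1 * r1 * (1 - a1)"
proof -
  have "c\<^sup>2 < speed\<^sup>2" using assms by (intro power_strict_mono) auto
  also have "\<dots> = 4 * (d1 * r1 * (1 - a1))" using pos by (simp add: speed_def power_mult_distrib)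
  finally show ?thesis by simp
qed

lemma u_eventually_ge_step:
  assumes v: "v_eventually_le \<beta>" and \<alpha>: "\<alpha> < 1 - a1 * \<beta>"
  shows "u_eventually_ge \<alpha>"
  unfolding u_eventually_ge_def
proof (intro allI impI)
  fix c assume c: "0 < c \<and> c < speed"
  define c' where "c' = (c + speed) / 2"
  have c': "c < c'" "0 < c'" "c' < speed" using c by (auto simp: c'_def)
  obtain \<delta> where \<delta>: "\<delta> > 0" "eventually (\<lambda>t. \<forall>x\<in>closure \<Omega>. norm x \<le> c' * t \<longrightarrow> \<delta> \<le> u t x) at_top"
    by (rule u_lower_bound[OF c'(2) below_speed[OF c'(2,3)]])
  have v': "eventually (\<lambda>t. \<forall>x\<in>closure \<Omega>. norm x \<le> c' * t \<longrightarrow> v t x \<le> \<beta>) at_top"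
    using v c' unfolding v_eventually_le_def by blast
  define \<sigma> where "\<sigma> = r1 * \<delta> * (1 - \<alpha> - a1 * \<beta>) / 2"
  have \<sigma>: "\<sigma> > 0" using \<alpha> \<delta>(1) pos by (simp add: \<sigma>_def)
  show "eventually (\<lambda>t. \<forall>x\<in>closure \<Omega>. norm x \<le> c * t \<longrightarrow> \<alpha> \<le> u t x) at_top"
  proof (rule eventually_lifted[OF ext C2 pos(1) eq_u cont_u, where M = 0 and c' = c' and \<sigma> = \<sigma>])
    show "eventually (\<lambda>t. \<forall>x\<in>\<Omega>. norm x \<le> c' * t \<longrightarrow> u t x < \<alpha> \<longrightarrow>
        2 * \<sigma> \<le> r1 * u t x * (1 - u t x - a1 * v t x)) at_top"
      using \<delta>(2) v'
    proof eventually_elim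
      case (elim t)
      show ?case
      proof (intro ballI impI)
        fix x assume x: "x \<in> \<Omega>" "norm x \<le> c' * t" "u t x < \<alpha>"
        have 1: "\<delta> \<le> u t x" "v t x \<le> \<beta>" using elim x in_closure by auto
        then have "a1 * v t x \<le> a1 * \<beta>" using pos by simp
        then have 2: "1 - \<alpha> - a1 * \<beta> \<le> 1 - u t x - a1 * v t x" using x(3) by linarith
        have "r1 * \<delta> * (1 - \<alpha> - a1 * \<beta>) \<le> r1 * u t x * (1 - u t x - a1 * v t x)"
          using 1 2 \<alpha> \<delta>(1) pos by (intro mult_mono) auto
        then show "2 * \<sigma> \<le> r1 * u t x * (1 - u t x - a1 * v t x)" by (simp add: \<sigma>_def)
      qed
    qed
  qed (use c c' \<sigma> u_nonneg in auto)
qed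

lemma v_eventually_le_step:
  assumes u: "u_eventually_ge \<alpha>" and \<beta>: "\<beta> > 0" "\<beta> > 1 - a2 * \<alpha>"
  shows "v_eventually_le \<beta>"
  unfolding v_eventually_le_def
proof (intro allI impI)
  fix c assume c: "0 < c \<and> c < speed"
  define c' where "c' = (c + speed) / 2"
  have c': "c < c'" "0 < c'" "c' < speed" using c by (auto simp: c'_def)
  have u': "eventually (\<lambda>t. \<forall>x\<in>closure \<Omega>. norm x \<le> c' * t \<longrightarrow> \<alpha> \<le> u t x) at_top"
    using u c' unfolding u_eventually_ge_def by blast
  define \<sigma> where "\<sigma> = r2 * \<beta> * (\<beta> - 1 + a2 * \<alpha>) / 2"
  have \<sigma>: "\<sigma> > 0" using \<beta> pos by (simp add: \<sigma>_def)
  have "eventually (\<lambda>t. \<forall>x\<in>closure \<Omega>. norm x \<le> c * t \<longrightarrow> - \<beta> \<le> - v t x) at_top"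
  proof (rule eventually_lifted[OF ext C2 pos(2) classical_neumann_eq_uminus[OF eq_v] cont_minus_v,
        where M = 1 and c' = c' and \<sigma> = \<sigma>])
    show "eventually (\<lambda>t. \<forall>x\<in>\<Omega>. norm x \<le> c' * t \<longrightarrow> - v t x < - \<beta> \<longrightarrow>
        2 * \<sigma> \<le> - (r2 * v t x * (1 - v t x - a2 * u t x))) at_top"
      using u'
    proof eventually_elim
      case (elim t)
      show ?case
      proof (intro ballI impI)
        fix x assume x: "x \<in> \<Omega>" "norm x \<le> c' * t" "- v t x < - \<beta>"
        have "\<alpha> \<le> u t x" using elim x in_closure by auto
        then have "a2 * \<alpha> \<le> a2 * u t x" using pos by simp
        then have "\<beta> - 1 + a2 * \<alpha> \<le> v t x - 1 + a2 * u t x" using x(3) by linarith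
        then have "r2 * \<beta> * (\<beta> - 1 + a2 * \<alpha>) \<le> r2 * v t x * (v t x - 1 + a2 * u t x)"
          using x(3) \<beta> pos by (intro mult_mono) auto
        moreover have "- (r2 * v t x * (1 - v t x - a2 * u t x)) = r2 * v t x * (v t x - 1 + a2 * u t x)"
          by (simp add: algebra_simps)
        ultimately show "2 * \<sigma> \<le> - (r2 * v t x * (1 - v t x - a2 * u t x))"
          by (simp only: \<sigma>_def)
      qed
    qed
  qed (use c c' \<sigma> v_le_1 in auto)
  then show "eventually (\<lambda>t. \<forall>x\<in>closure \<Omega>. norm x \<le> c * t \<longrightarrow> v t x \<le> \<beta>) at_top" by simp
qed

lemma u_eventually_ge_mono: "u_eventually_ge \<alpha> \<Longrightarrow> \<alpha>' \<le> \<alpha> \<Longrightarrow> u_eventually_ge \<alpha>'"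
  unfolding u_eventually_ge_def by (fast elim: eventually_mono intro: order.trans)

lemma u_eventually_ge_le_1:
  assumes "u_eventually_ge \<alpha>"
  shows "\<alpha> \<le> 1"
proof -
  obtain x where x: "x \<in> \<Omega>" using ext by (auto simp: exterior_domain_def)
  define c where "c = speed / 2"
  have c: "0 < c" "c < speed" using speed_pos by (auto simp: c_def)
  have "eventually (\<lambda>t. \<forall>x\<in>closure \<Omega>. norm x \<le> c * t \<longrightarrow> \<alpha> \<le> u t x) at_top"
    using assms c unfolding u_eventually_ge_def by blast
  moreover have "eventually (\<lambda>t. t \<ge> norm x / c) at_top" by (rule eventually_ge_at_top)
  ultimately have "eventually (\<lambda>t::real. \<alpha> \<le> 1) at_top"
  proof eventually_elim
    case (elim t)
    have "norm x \<le> c * t" using elim(2) c by (simp add: pos_divide_le_eq mult.commute)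
    moreover have "t \<ge> 0" using elim(2) c by (rule_tac order.trans[OF _ elim(2)]) simp
    ultimately show ?case using elim(1) in_closure[OF x] u_le_1[of t x] by force
  qed
  then show ?thesis by simp
qed

text \<open>The supremum \<open>U\<close> of the admissible lower bounds satisfies \<open>U \<ge> 1 - a1 * max 0 (1 - a2 * U)\<close>
  and \<open>U \<ge> 1 - a1 > 0\<close>, which forces \<open>U = 1\<close> because \<open>a1 < 1 < a2\<close>.\<close>
lemma u_eventually_ge_all:
  assumes "\<alpha> < 1"
  shows "u_eventually_ge \<alpha>"
proof -
  define S where "S = {\<alpha>. u_eventually_ge \<alpha>}"
  define U where "U = Sup S"
  have "eventually (\<lambda>t. \<forall>x\<in>closure \<Omega>. norm x \<le> c * t \<longrightarrow> v t x \<le> 1) at_top" for c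
    using v_le_1 by (intro eventually_at_top_linorderI[of 0]) auto
  then have v1: "v_eventually_le 1" unfolding v_eventually_le_def by blast
  have start: "\<gamma> \<in> S" if "\<gamma> < 1 - a1" for \<gamma>
    using u_eventually_ge_step[OF v1, of \<gamma>] that by (simp add: S_def)
  have bdd: "bdd_above S" using u_eventually_ge_le_1 by (auto simp: S_def bdd_above_def)
  have ne: "S \<noteq> {}" using start[of "- a1"] by auto
  have below: "u_eventually_ge \<gamma>" if g: "\<gamma> < U" for \<gamma>
  proof -
    obtain \<gamma>' where "\<gamma>' \<in> S" "\<gamma> < \<gamma>'" using less_cSupD[OF ne] g unfolding U_def by blast
    then show ?thesis using u_eventually_ge_mono[of \<gamma>' \<gamma>] by (simp add: S_def)
  qed
  have upper: "\<gamma> \<le> U" if "\<And>\<gamma>'. \<gamma>' < \<gamma> \<Longrightarrow> u_eventually_ge \<gamma>'" for \<gamma>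
    by (rule dense_le) (use that cSup_upper[OF _ bdd] in \<open>auto simp: U_def S_def\<close>)
  have Upos: "U \<ge> 1 - a1" by (rule upper) (use start in \<open>auto simp: S_def\<close>)
  have vb: "v_eventually_le \<beta>" if \<beta>: "\<beta> > 0" "\<beta> > 1 - a2 * U" for \<beta>
  proof -
    have "(1 - \<beta>) / a2 < U" using \<beta> pos by (simp add: pos_divide_less_eq mult.commute)
    then obtain \<gamma> where \<gamma>: "(1 - \<beta>) / a2 < \<gamma>" "\<gamma> < U" using dense by blast
    then have "1 - \<beta> < a2 * \<gamma>" using pos by (simp add: pos_divide_less_eq mult.commute)
    then show ?thesis using v_eventually_le_step[OF below[OF \<gamma>(2)] \<beta>(1)] by simp
  qed
  have fix_ineq: "U \<ge> 1 - a1 * max 0 (1 - a2 * U)"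
  proof (rule upper)
    fix \<gamma>' assume g: "\<gamma>' < 1 - a1 * max 0 (1 - a2 * U)"
    have "max 0 (1 - a2 * U) * a1 < 1 - \<gamma>'" using g mult.commute[of a1 "max 0 (1 - a2 * U)"] by linarith
    then have "max 0 (1 - a2 * U) < (1 - \<gamma>') / a1" by (simp only: pos_less_divide_eq[OF pos(5)])
    then obtain \<beta> where \<beta>: "max 0 (1 - a2 * U) < \<beta>" "\<beta> < (1 - \<gamma>') / a1" using dense by blast
    then have "\<gamma>' < 1 - a1 * \<beta>" using pos by (simp add: pos_less_divide_eq mult.commute)
    moreover have "v_eventually_le \<beta>" by (rule vb) (use \<beta> in auto)
    ultimately show "u_eventually_ge \<gamma>'" using u_eventually_ge_step by blast
  qed
  have "U \<ge> 1"
  proof (rule ccontr)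
    assume "\<not> U \<ge> 1"
    then have lt: "1 - a2 * U > 0" using fix_ineq by (cases "1 - a2 * U > 0") auto
    then have "1 - U \<le> a1 * (1 - a2 * U)" using fix_ineq by simp
    also have "\<dots> < 1 * (1 - a2 * U)" using lt pos by (intro mult_strict_right_mono) auto
    finally have "a2 * U < 1 * U" by simp
    then show False using Upos pos mult_right_mono[of 1 a2 U] by auto
  qed
  then show ?thesis using below assms by auto
qed

lemma v_eventually_le_all:
  assumes "\<beta> > 0"
  shows "v_eventually_le \<beta>"
proof -
  have "(1 - \<beta>) / a2 < 1" using assms pos by (simp add: pos_divide_less_eq)
  then obtain \<gamma> where \<gamma>: "(1 - \<beta>) / a2 < \<gamma>" "\<gamma> < 1" using dense by blast
  then have "1 - \<beta> < a2 * \<gamma>" using pos by (simp add: pos_divide_less_eq mult.commute)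
  then show ?thesis using v_eventually_le_step[OF u_eventually_ge_all[OF \<gamma>(2)] assms] by simp
qed

lemma spreading:
  assumes c: "0 \<le> c" "c < speed" and \<epsilon>: "\<epsilon> > 0"
  shows "eventually (\<lambda>t. \<forall>x\<in>closure \<Omega>. norm x \<le> c * t \<longrightarrow> \<bar>1 - u t x\<bar> + \<bar>v t x\<bar> < \<epsilon>) at_top"
proof -
  define c' where "c' = (c + speed) / 2"
  have c': "c \<le> c'" "0 < c'" "c' < speed" using c speed_pos by (auto simp: c'_def)
  have "u_eventually_ge (1 - \<epsilon> / 3)" "v_eventually_le (\<epsilon> / 3)"
    using u_eventually_ge_all v_eventually_le_all \<epsilon> by auto
  then have "eventually (\<lambda>t. \<forall>x\<in>closure \<Omega>. norm x \<le> c' * t \<longrightarrow> 1 - \<epsilon> / 3 \<le> u t x) at_top"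
    "eventually (\<lambda>t. \<forall>x\<in>closure \<Omega>. norm x \<le> c' * t \<longrightarrow> v t x \<le> \<epsilon> / 3) at_top"
    using c' unfolding u_eventually_ge_def v_eventually_le_def by blast+
  moreover have "eventually (\<lambda>t::real. 0 \<le> t) at_top" by (rule eventually_ge_at_top)
  ultimately show ?thesis
  proof eventually_elim
    case (elim t)
    show ?case
    proof (intro ballI impI)
      fix x assume x: "x \<in> closure \<Omega>" "norm x \<le> c * t"
      have "c * t \<le> c' * t" using c' elim(3) by (intro mult_right_mono)
      then have "1 - \<epsilon> / 3 \<le> u t x" "v t x \<le> \<epsilon> / 3" using elim x by auto
      then show "\<bar>1 - u t x\<bar> + \<bar>v t x\<bar> < \<epsilon>"
        using u_le_1[OF elim(3) x(1)] v_nonneg[OF elim(3) x(1)] \<epsilon> by linarith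
    qed
  qed
qed

lemma w_lower_ge_speed:
  assumes e: "norm e = 1"
  shows "ereal speed \<le> w_lower \<Omega> u v e"
proof -
  define C where "C = {c. c > 0 \<and> (\<forall>A > R_dir \<Omega> e. \<forall>\<epsilon>>0. \<exists>T. \<forall>\<tau> t.
      T \<le> \<tau> \<longrightarrow> T \<le> t \<longrightarrow> \<tau> \<le> c * t \<longrightarrow>
        (\<forall>s. \<tau> \<le> s \<and> s \<le> c * t \<longrightarrow> (\<forall>x\<in>cball (s *\<^sub>R e) A \<inter> closure \<Omega>.
              \<bar>1 - u t x\<bar> + \<bar>v t x\<bar> < \<epsilon>)))}"
  have mem: "c \<in> C" if c: "0 < c" "c < speed" for c
    unfolding C_def
  proof (intro CollectI conjI allI impI)
    fix A \<epsilon> :: real assume \<epsilon>: "\<epsilon> > 0"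
    define c' where "c' = (c + speed) / 2"
    have c': "c < c'" "0 \<le> c'" "c' < speed" using c by (auto simp: c'_def)
    obtain T where T: "\<And>t x. t \<ge> T \<Longrightarrow> x \<in> closure \<Omega> \<Longrightarrow> norm x \<le> c' * t \<Longrightarrow> \<bar>1 - u t x\<bar> + \<bar>v t x\<bar> < \<epsilon>"
      using spreading[OF c'(2,3) \<epsilon>] unfolding eventually_at_top_linorder by blast
    show "\<exists>T. \<forall>\<tau> t. T \<le> \<tau> \<longrightarrow> T \<le> t \<longrightarrow> \<tau> \<le> c * t \<longrightarrow>
        (\<forall>s. \<tau> \<le> s \<and> s \<le> c * t \<longrightarrow> (\<forall>x\<in>cball (s *\<^sub>R e) A \<inter> closure \<Omega>. \<bar>1 - u t x\<bar> + \<bar>v t x\<bar> < \<epsilon>))"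
    proof (intro exI[of _ "max 0 (max T (A / (c' - c)))"] allI impI ballI)
      fix \<tau> t s x assume \<tau>: "max 0 (max T (A / (c' - c))) \<le> \<tau>" and t: "max 0 (max T (A / (c' - c))) \<le> t"
        and s: "\<tau> \<le> s \<and> s \<le> c * t" and x: "x \<in> cball (s *\<^sub>R e) A \<inter> closure \<Omega>"
      have "norm x \<le> norm (s *\<^sub>R e) + A"
        using x norm_triangle_ineq[of "x - s *\<^sub>R e" "s *\<^sub>R e"] by (simp add: dist_norm norm_minus_commute)
      also have "norm (s *\<^sub>R e) = s" using e s \<tau> by simp
      finally have "norm x \<le> c * t + A" using s by simp
      also have "A \<le> t * (c' - c)" using t c' by (simp add: pos_divide_le_eq)
      finally have "norm x \<le> c' * t" by (simp add: algebra_simps)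
      then show "\<bar>1 - u t x\<bar> + \<bar>v t x\<bar> < \<epsilon>" using T[of t x] t x by auto
    qed
  qed (use c in simp)
  have half: "speed / 2 \<in> C" using mem[of "speed / 2"] speed_pos by simp
  have "ereal speed \<le> Sup (ereal ` C)"
  proof (rule ccontr)
    assume "\<not> ereal speed \<le> Sup (ereal ` C)"
    then obtain c where c: "Sup (ereal ` C) < ereal c" "ereal c < ereal speed"
      using ereal_dense2 by (metis not_le)
    have "ereal (speed / 2) < ereal c" using Sup_upper[of "ereal (speed / 2)" "ereal ` C"] half c(1) by (metis imageI le_less_trans)
    then have "c \<in> C" using mem[of c] c(2) speed_pos by simp
    then show False using Sup_upper[of "ereal c" "ereal ` C"] c(1) by (simp add: leD)
  qed
  then show ?thesis using half unfolding w_lower_def Let_def C_def[symmetric] by auto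
qed

lemma w_lower_z_le_w_upper_z:
  assumes e: "norm e = 1"
  shows "w_lower_z \<Omega> u v e z \<le> w_upper_z \<Omega> u v e z"
proof -
  obtain R where R: "R > 0" "\<And>x. x \<notin> \<Omega> \<Longrightarrow> norm x < R"
      "\<And>x. x \<in> frontier \<Omega> \<Longrightarrow> norm x < R" "compact (frontier \<Omega>)"
    by (rule exterior_domain_frontier[OF ext]) (rule that; blast)
  define C where "C = {c. c > 0 \<and> (\<exists>A > 0. \<forall>\<epsilon>>0. \<exists>T. \<forall>\<tau> t.
      T \<le> \<tau> \<longrightarrow> T \<le> t \<longrightarrow> \<tau> \<le> c * t \<longrightarrow>
        (\<forall>s. \<tau> \<le> s \<and> s \<le> c * t \<longrightarrow> (\<forall>x\<in>cball (z + s *\<^sub>R e) A \<inter> closure \<Omega>.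
              \<bar>1 - u t x\<bar> + \<bar>v t x\<bar> < \<epsilon>)))}"
  define D where "D = {c. c > 0 \<and> (\<exists>A > 0. \<forall>\<epsilon>>0.
      eventually (\<lambda>t. \<forall>s \<ge> c * t. \<forall>x\<in>cball (z + s *\<^sub>R e) A \<inter> closure \<Omega>.
                         \<bar>u t x\<bar> + \<bar>1 - v t x\<bar> < \<epsilon>) at_top)}"
  have le: "c \<le> b" if c: "c \<in> C" and b: "b \<in> D" for c b
  proof (rule ccontr)
    assume "\<not> c \<le> b"
    then have bc: "b < c" by simp
    have cp: "c > 0" using c by (simp add: C_def)
    obtain A where A: "A > 0" "\<forall>\<epsilon>>0. \<exists>T. \<forall>\<tau> t. T \<le> \<tau> \<longrightarrow> T \<le> t \<longrightarrow> \<tau> \<le> c * t \<longrightarrow>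
        (\<forall>s. \<tau> \<le> s \<and> s \<le> c * t \<longrightarrow> (\<forall>x\<in>cball (z + s *\<^sub>R e) A \<inter> closure \<Omega>.
              \<bar>1 - u t x\<bar> + \<bar>v t x\<bar> < \<epsilon>))" using c unfolding C_def by blast
    obtain A' where A': "A' > 0" "\<forall>\<epsilon>>0. eventually (\<lambda>t. \<forall>s \<ge> b * t. \<forall>x\<in>cball (z + s *\<^sub>R e) A' \<inter> closure \<Omega>.
                         \<bar>u t x\<bar> + \<bar>1 - v t x\<bar> < \<epsilon>) at_top" using b unfolding D_def by blast
    have half: "(1/2::real) > 0" by simp
    obtain T where T: "\<And>\<tau> t s x. T \<le> \<tau> \<Longrightarrow> T \<le> t \<Longrightarrow> \<tau> \<le> c * t \<Longrightarrow> \<tau> \<le> s \<Longrightarrow> s \<le> c * t \<Longrightarrow>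
        x \<in> cball (z + s *\<^sub>R e) A \<Longrightarrow> x \<in> closure \<Omega> \<Longrightarrow> \<bar>1 - u t x\<bar> + \<bar>v t x\<bar> < 1/2"
      using A(2)[rule_format, OF half] by blast
    obtain T' where T': "\<And>t s x. T' \<le> t \<Longrightarrow> b * t \<le> s \<Longrightarrow>
        x \<in> cball (z + s *\<^sub>R e) A' \<Longrightarrow> x \<in> closure \<Omega> \<Longrightarrow> \<bar>u t x\<bar> + \<bar>1 - v t x\<bar> < 1/2"
      using A'(2)[rule_format, OF half] unfolding eventually_at_top_linorder by blast
    define t where "t = Max {0, T, T', T / c, (R + norm z) / c}"
    have t: "0 \<le> t" "T \<le> t" "T' \<le> t" "T / c \<le> t" "(R + norm z) / c \<le> t" by (auto simp: t_def)
    have Tc: "T \<le> c * t" "R + norm z \<le> c * t" using t(4,5) cp by (simp_all add: pos_divide_le_eq mult.commute)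
    define x where "x = z + (c * t) *\<^sub>R e"
    have "norm ((c * t) *\<^sub>R e) \<le> norm x + norm z"
      using norm_triangle_ineq4[of x z] by (simp add: x_def)
    moreover have "norm ((c * t) *\<^sub>R e) = c * t" using e cp t(1) by simp
    ultimately have "\<not> norm x < R" using Tc(2) by linarith
    then have x: "x \<in> closure \<Omega>" using R(2) in_closure by blast
    have "b * t \<le> c * t" using bc t(1) by (intro mult_right_mono) auto
    then have "\<bar>u t x\<bar> + \<bar>1 - v t x\<bar> < 1/2"
      using T'[OF t(3) _ _ x, of "c * t"] A'(1) by (simp add: x_def)
    moreover have "\<bar>1 - u t x\<bar> + \<bar>v t x\<bar> < 1/2"
      using T[OF Tc(1) t(2) order.refl order.refl order.refl _ x] A(1) by (simp add: x_def)
    ultimately show False by linarith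
  qed
  have "w_lower_z \<Omega> u v e z \<le> ereal b" if b: "b \<in> D" for b
  proof (cases "C = {}")
    case True
    have "b > 0" using b by (simp add: D_def)
    then show ?thesis using True unfolding w_lower_z_def Let_def C_def[symmetric] by simp
  next
    case False
    have "Sup (ereal ` C) \<le> ereal b" using le[OF _ b] by (auto intro: Sup_least)
    then show ?thesis using False unfolding w_lower_z_def Let_def C_def[symmetric] by simp
  qed
  then show ?thesis unfolding w_upper_z_def D_def[symmetric] by (auto intro: Inf_greatest)
qed

end

lemma cball_translate_subset:
  fixes z e :: "'a::real_normed_vector"
  shows "cball (z + s *\<^sub>R e) 1 \<subseteq> cball (s *\<^sub>R e) (1 + norm z + \<bar>r\<bar>)"
proof
  fix x assume "x \<in> cball (z + s *\<^sub>R e) 1"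
  then show "x \<in> cball (s *\<^sub>R e) (1 + norm z + \<bar>r\<bar>)"
    using dist_triangle[of "s *\<^sub>R e" x "z + s *\<^sub>R e"] by (simp add: dist_norm)
qed

lemma w_upper_z_le_w_upper: "w_upper_z \<Omega> u v e z \<le> w_upper \<Omega> u v e"
proof -
  define C where "C = {c. c > 0 \<and> (\<forall>A > R_dir \<Omega> e. \<forall>\<epsilon>>0.
      eventually (\<lambda>t. \<forall>s \<ge> c * t. \<forall>x\<in>cball (s *\<^sub>R e) A \<inter> closure \<Omega>.
                         \<bar>u t x\<bar> + \<bar>1 - v t x\<bar> < \<epsilon>) at_top)}"
  define C' where "C' = {c. c > 0 \<and> (\<exists>A > 0. \<forall>\<epsilon>>0.
      eventually (\<lambda>t. \<forall>s \<ge> c * t. \<forall>x\<in>cball (z + s *\<^sub>R e) A \<inter> closure \<Omega>.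
                         \<bar>u t x\<bar> + \<bar>1 - v t x\<bar> < \<epsilon>) at_top)}"
  have "C \<subseteq> C'"
  proof
    fix c assume c: "c \<in> C"
    have lt: "R_dir \<Omega> e < 1 + norm z + \<bar>R_dir \<Omega> e\<bar>" using norm_ge_zero[of z] by linarith
    show "c \<in> C'" unfolding C'_def
    proof (intro CollectI conjI exI[of _ 1] allI impI)
      show "c > 0" using c by (simp add: C_def)
      fix \<epsilon> :: real assume "\<epsilon> > 0"
      then have "eventually (\<lambda>t. \<forall>s \<ge> c * t. \<forall>x\<in>cball (s *\<^sub>R e) (1 + norm z + \<bar>R_dir \<Omega> e\<bar>) \<inter> closure \<Omega>.
                         \<bar>u t x\<bar> + \<bar>1 - v t x\<bar> < \<epsilon>) at_top"
        using c lt unfolding C_def by blast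
      then show "eventually (\<lambda>t. \<forall>s \<ge> c * t. \<forall>x\<in>cball (z + s *\<^sub>R e) 1 \<inter> closure \<Omega>.
                         \<bar>u t x\<bar> + \<bar>1 - v t x\<bar> < \<epsilon>) at_top"
        by (rule eventually_mono) (use cball_translate_subset[of z _ e "R_dir \<Omega> e"] in blast)
    qed simp
  qed
  then show ?thesis
    unfolding w_upper_def w_upper_z_def C_def[symmetric] C'_def[symmetric]
    by (intro Inf_superset_mono image_mono)
qed

lemma w_lower_le_w_lower_z: "w_lower \<Omega> u v e \<le> w_lower_z \<Omega> u v e z"
proof -
  define C where "C = {c. c > 0 \<and> (\<forall>A > R_dir \<Omega> e. \<forall>\<epsilon>>0. \<exists>T. \<forall>\<tau> t.
      T \<le> \<tau> \<longrightarrow> T \<le> t \<longrightarrow> \<tau> \<le> c * t \<longrightarrow>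
        (\<forall>s. \<tau> \<le> s \<and> s \<le> c * t \<longrightarrow> (\<forall>x\<in>cball (s *\<^sub>R e) A \<inter> closure \<Omega>.
              \<bar>1 - u t x\<bar> + \<bar>v t x\<bar> < \<epsilon>)))}"
  define C' where "C' = {c. c > 0 \<and> (\<exists>A > 0. \<forall>\<epsilon>>0. \<exists>T. \<forall>\<tau> t.
      T \<le> \<tau> \<longrightarrow> T \<le> t \<longrightarrow> \<tau> \<le> c * t \<longrightarrow>
        (\<forall>s. \<tau> \<le> s \<and> s \<le> c * t \<longrightarrow> (\<forall>x\<in>cball (z + s *\<^sub>R e) A \<inter> closure \<Omega>.
              \<bar>1 - u t x\<bar> + \<bar>v t x\<bar> < \<epsilon>)))}"
  have sub: "C \<subseteq> C'"
  proof
    fix c assume c: "c \<in> C"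
    have lt: "R_dir \<Omega> e < 1 + norm z + \<bar>R_dir \<Omega> e\<bar>" using norm_ge_zero[of z] by linarith
    show "c \<in> C'" unfolding C'_def
    proof (rule CollectI, rule conjI, use c in \<open>simp add: C_def\<close>, rule exI[of _ 1],
        rule conjI, rule zero_less_one, intro allI impI)
      fix \<epsilon> :: real assume "\<epsilon> > 0"
      then obtain T where "\<forall>\<tau> t. T \<le> \<tau> \<longrightarrow> T \<le> t \<longrightarrow> \<tau> \<le> c * t \<longrightarrow>
        (\<forall>s. \<tau> \<le> s \<and> s \<le> c * t \<longrightarrow> (\<forall>x\<in>cball (s *\<^sub>R e) (1 + norm z + \<bar>R_dir \<Omega> e\<bar>) \<inter> closure \<Omega>.
              \<bar>1 - u t x\<bar> + \<bar>v t x\<bar> < \<epsilon>))"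
        using c lt unfolding C_def by blast
      then show "\<exists>T. \<forall>\<tau> t. T \<le> \<tau> \<longrightarrow> T \<le> t \<longrightarrow> \<tau> \<le> c * t \<longrightarrow>
        (\<forall>s. \<tau> \<le> s \<and> s \<le> c * t \<longrightarrow> (\<forall>x\<in>cball (z + s *\<^sub>R e) 1 \<inter> closure \<Omega>.
              \<bar>1 - u t x\<bar> + \<bar>v t x\<bar> < \<epsilon>))"
        using cball_translate_subset[of z _ e "R_dir \<Omega> e"] by (intro exI[of _ T]) blast
    qed
  qed
  show ?thesis
  proof (cases "C = {}")
    case True
    have "0 \<le> (if C' = {} then 0 else Sup (ereal ` C'))"
    proof (cases "C' = {}")
      case False
      then obtain c where c: "c \<in> C'" by blast
      then have "0 \<le> ereal c" by (simp add: C'_def)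
      also have "\<dots> \<le> Sup (ereal ` C')" using c by (intro Sup_upper) auto
      finally show ?thesis using False by simp
    qed simp
    then show ?thesis using True unfolding w_lower_def w_lower_z_def Let_def C_def[symmetric] C'_def[symmetric] by simp
  next
    case False
    then have "C' \<noteq> {}" using sub by blast
    then show ?thesis using False sub unfolding w_lower_def w_lower_z_def Let_def C_def[symmetric] C'_def[symmetric]
      by (simp add: Sup_subset_mono image_mono)
  qed
qed

theorem mainTheorem9:
  fixes \<Omega> :: "'a::euclidean_space set"
    and d1 d2 r1 r2 a1 a2 :: real
    and u0 v0 :: "'a \<Rightarrow> real"
    and u v :: "real \<Rightarrow> 'a \<Rightarrow> real"
  assumes "DIM('a) \<ge> 2"
    and "exterior_domain \<Omega>" and "C2_domain \<Omega>"
    and "d1 > 0" "d2 > 0" "r1 > 0" "r2 > 0" "0 < a1" "a1 < 1" "1 < a2"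
    and "in_Theta \<Omega> u0 v0"
    and "LV_solution \<Omega> d1 d2 r1 r2 a1 a2 u0 v0 u v"
  shows "(\<forall>c. 0 \<le> c \<and> c < 2 * sqrt (d1 * r1 * (1 - a1)) \<longrightarrow>
            (\<forall>\<epsilon>>0. eventually (\<lambda>t. \<forall>x\<in>closure \<Omega>. norm x \<le> c * t \<longrightarrow>
                        \<bar>1 - u t x\<bar> + \<bar>v t x\<bar> < \<epsilon>) at_top))
       \<and> (\<forall>e z. norm e = 1 \<longrightarrow>
            w_upper \<Omega> u v e \<ge> w_upper_z \<Omega> u v e z
          \<and> w_upper_z \<Omega> u v e z \<ge> w_lower_z \<Omega> u v e z
          \<and> w_lower_z \<Omega> u v e z \<ge> w_lower \<Omega> u v e
          \<and> w_lower \<Omega> u v e \<ge> ereal (2 * sqrt (d1 * r1 * (1 - a1))))"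
proof -
  interpret competition_system \<Omega> d1 d2 r1 r2 a1 a2 u0 v0 u v
    by unfold_locales (use assms in auto)
  show ?thesis
    using spreading w_upper_z_le_w_upper w_lower_z_le_w_upper_z w_lower_le_w_lower_z w_lower_ge_speed
    unfolding speed_def by blast
qed

end
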